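(* Let $p:\mathbb{R}^{2n}\to\mathbb{R}$ be a smooth function with $\frac{\partial p}{\partial x_1}(x,y)>0$ for all $(x,y)$ in some open set $O\subseteq\mathbb{R}^{2n}$. Then for $(x,y)\in O$ there exist a neighborhood $U$ in $\mathbb{R}^{2n}$ of $(x,y)$ and a symplectomorphism $f:U\to\mathbb{R}^{2n}$ such that $f^*p=x_1$.
   Context: Coordinates on $\mathbb{R}^{2n}$ are $(x,y)=(x_1,\dots,x_n,y_1,\dots,y_n)$, and $\mathbb{R}^{2n}$ carries the standard symplectic form $\omega_0=\sum_{i=1}^n dx_i\wedge dy_i$. A symplectomorphism $f:U\to\mathbb{R}^{2n}$ defined on an open set $U$ is a diffeomorphism onto its image with $f^*\omega_0=\omega_0$. Here $f^*p=p\circ f$, and $x_1$ denotes the first coordinate function on $U$.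
   Formalization: As stated this fails (p = -exp(-x_1) at a point with x_1 ≥ 0, since p < 0). Proved instead: U is a neighborhood of the point obtained from (x,y) by replacing its first coordinate with p(x,y), and f maps that point to (x,y). *)

theory Defs
  imports "HOL-Analysis.Analysis"
begin

type_synonym 'n phase_space = "(real ^ 'n) \<times> (real ^ 'n)"

definition coord_x :: "'n::finite \<Rightarrow> 'n phase_space \<Rightarrow> real" where
  "coord_x i z = fst z $ i"

definition coord_y :: "'n::finite \<Rightarrow> 'n phase_space \<Rightarrow> real" where
  "coord_y i z = snd z $ i"

text \<open>The index type is linearly ordered so that it has a first element; the coordinate
  written $x_1$ on paper is \<open>coord_x first_index\<close>.\<close>

definition first_index :: "'n::{finite,linorder}" where
  "first_index = Min UNIV"

definition e_x :: "'n::finite \<Rightarrow> 'n phase_space" where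
  "e_x i = (axis i 1, 0)"

definition partial_x :: "'n::finite \<Rightarrow> ('n phase_space \<Rightarrow> real) \<Rightarrow> 'n phase_space \<Rightarrow> real" where
  "partial_x i p z = deriv (\<lambda>t. p (z + t *\<^sub>R e_x i)) 0"

text \<open>The class $C^k$ is only meaningful here for open sets, since derivatives are taken
  in the ambient space.\<close>

primrec Ck_on :: "nat \<Rightarrow> 'a::real_normed_vector set \<Rightarrow> ('a \<Rightarrow> 'b::real_normed_vector) \<Rightarrow> bool" where
  "Ck_on 0 S f \<longleftrightarrow> continuous_on S f"
| "Ck_on (Suc k) S f \<longleftrightarrow>
     (\<forall>x\<in>S. f differentiable (at x)) \<and>
     (\<forall>v. Ck_on k S (\<lambda>x. frechet_derivative f (at x) v))"

definition smooth_on :: "'a::real_normed_vector set \<Rightarrow> ('a \<Rightarrow> 'b::real_normed_vector) \<Rightarrow> bool" where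
  "smooth_on S f \<longleftrightarrow> (\<forall>k. Ck_on k S f)"

definition diffeomorphism_onto_image ::
  "'a::real_normed_vector set \<Rightarrow> ('a \<Rightarrow> 'b::real_normed_vector) \<Rightarrow> bool" where
  "diffeomorphism_onto_image U f \<longleftrightarrow>
     open U \<and> open (f ` U) \<and> inj_on f U \<and>
     smooth_on U f \<and> smooth_on (f ` U) (the_inv_into U f)"

text \<open>A differential $k$-form is a function of the base point followed by $k$ tangent vectors.
  The wedge product of one-forms is normalised without the factor $1/2$.\<close>

definition differential :: "('a::real_normed_vector \<Rightarrow> real) \<Rightarrow> 'a \<Rightarrow> 'a \<Rightarrow> real" where
  "differential h z = frechet_derivative h (at z)"

definition wedge :: "('a \<Rightarrow> 'a \<Rightarrow> real) \<Rightarrow> ('a \<Rightarrow> 'a \<Rightarrow> real) \<Rightarrow> 'a \<Rightarrow> 'a \<Rightarrow> 'a \<Rightarrow> real" where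
  "wedge \<alpha> \<beta> z u v = \<alpha> z u * \<beta> z v - \<alpha> z v * \<beta> z u"

definition omega0 :: "'n::finite phase_space \<Rightarrow> 'n phase_space \<Rightarrow> 'n phase_space \<Rightarrow> real" where
  "omega0 z u v = (\<Sum>i\<in>UNIV. wedge (differential (coord_x i)) (differential (coord_y i)) z u v)"

definition pullback2 ::
  "('a::real_normed_vector \<Rightarrow> 'b::real_normed_vector) \<Rightarrow> ('b \<Rightarrow> 'b \<Rightarrow> 'b \<Rightarrow> real) \<Rightarrow> 'a \<Rightarrow> 'a \<Rightarrow> 'a \<Rightarrow> real" where
  "pullback2 f \<omega> z u v =
     \<omega> (f z) (frechet_derivative f (at z) u) (frechet_derivative f (at z) v)"

definition symplectomorphism_on ::
  "'n::finite phase_space set \<Rightarrow> ('n phase_space \<Rightarrow> 'n phase_space) \<Rightarrow> bool" where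
  "symplectomorphism_on U f \<longleftrightarrow>
     diffeomorphism_onto_image U f \<and> (\<forall>z\<in>U. pullback2 f omega0 z = omega0 z)"

text \<open>If $p(f(w)) = x_1(w)$ and $f(w) = z$, then necessarily $x_1(w) = p(z)$. So a symplectomorphism
  onto a neighbourhood of \<open>z\<close> that turns \<open>p\<close> into $x_1$ can be defined near \<open>z\<close> itself and fix it only if
  $p(z) = x_1(z)$. For $p = -\exp(-x_1)$, whose partial derivative is positive everywhere, and
  a point \<open>z\<close> with $x_1(z) \ge 0$, no function \<open>f\<close> on any set containing \<open>z\<close>, fixing \<open>z\<close> or not,
  satisfies $p \circ f = x_1$. The domain is therefore centred at the point obtained from
  \<open>z\<close> by replacing its first coordinate by $p(z)$; it is \<open>z\<close> whenever $p(z) = x_1(z)$.\<close>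

definition source_point ::
  "('n::{finite,linorder} phase_space \<Rightarrow> real) \<Rightarrow> 'n phase_space \<Rightarrow> 'n phase_space" where
  "source_point p z = z + (p z - coord_x first_index z) *\<^sub>R e_x first_index"

end

theory Submission
  imports Defs
begin

text \<open>Let \<open>\<Psi> (t, s)\<close> be the flow of the Hamiltonian vector field \<open>X\<^sub>p\<close>, which preserves \<open>p\<close>. As a map of
  \<open>(t, s)\<close> it satisfies \<open>\<Psi>\<^sup>*\<omega>\<^sub>0 = \<omega>\<^sub>0 + dt \<and> dp\<close>. The \<open>y\<^sub>1\<close>-component of \<open>X\<^sub>p\<close> is \<open>- \<partial>p/\<partial>x\<^sub>1 \<noteq> 0\<close>, so the
  hyperplane \<open>y\<^sub>1 = y\<^sub>1(z)\<close> is transverse to the flow, and \<open>p\<close> may replace \<open>x\<^sub>1\<close> as a coordinate on it.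
  Let \<open>\<sigma> w\<close> be the point of the hyperplane with \<open>p (\<sigma> w) = x\<^sub>1 w\<close> that agrees with \<open>w\<close> in the other
  coordinates. Then \<open>f w = \<Psi> (y\<^sub>1 z - y\<^sub>1 w, \<sigma> w)\<close> turns \<open>p\<close> into \<open>x\<^sub>1\<close>, and \<open>\<sigma>\<^sup>*\<omega>\<^sub>0 = \<omega>\<^sub>0 - dx\<^sub>1 \<and> dy\<^sub>1\<close>
  cancels the extra term \<open>- dy\<^sub>1 \<and> dx\<^sub>1\<close> of the pullback under \<open>\<Psi>\<close>.

  Smooth dependence of the flow on \<open>(t, s)\<close> is obtained in the Banach space of bounded curves: there the flow
  equation reads \<open>\<gamma> = s + t N \<gamma>\<close>, its derivative is expressed by the inverse of the operator
  \<open>1 - t N'(\<gamma>)\<close>, and inversion of operators preserves \<open>C\<^sup>k\<close>, so that the order of differentiability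
  of the solution can be raised step by step.\<close>

subsection \<open>Calculus of \<open>C\<^sup>k\<close> functions\<close>

lemma Ck_on_cong:
  assumes "open S" "Ck_on k S f" "\<And>x. x \<in> S \<Longrightarrow> f x = g x"
  shows "Ck_on k S g"
  using assms(2,3)
proof (induction k arbitrary: f g)
  case 0
  then show ?case by (auto cong: continuous_on_cong)
next
  case (Suc k)
  have der: "(g has_derivative frechet_derivative f (at x)) (at x)" if "x \<in> S" for x
  proof (rule has_derivative_transform_within_open)
    show "(f has_derivative frechet_derivative f (at x)) (at x)"
      using Suc.prems that by (simp add: frechet_derivative_works)
  qed (use that assms(1) Suc.prems in auto)
  have eq: "frechet_derivative f (at x) = frechet_derivative g (at x)" if "x \<in> S" for x
    using frechet_derivative_at[OF der[OF that]] .
  have "Ck_on k S (\<lambda>x. frechet_derivative g (at x) v)" for v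
    by (rule Suc.IH[of "\<lambda>x. frechet_derivative f (at x) v"]) (use Suc.prems eq in auto)
  moreover have "g differentiable (at x)" if "x \<in> S" for x
    using der[OF that] differentiableI by blast
  ultimately show ?case by simp
qed

lemma Ck_on_SucI:
  assumes "open S" "\<And>x. x \<in> S \<Longrightarrow> (f has_derivative f' x) (at x)"
    and "\<And>v. Ck_on k S (\<lambda>x. f' x v)"
  shows "Ck_on (Suc k) S f"
proof -
  have "Ck_on k S (\<lambda>x. frechet_derivative f (at x) v)" for v
    by (rule Ck_on_cong[OF assms(1) assms(3)[of v]]) (metis assms(2) frechet_derivative_at)
  moreover have "f differentiable (at x)" if "x \<in> S" for x
    using assms(2)[OF that] differentiableI by blast
  ultimately show ?thesis by simp
qed

lemma Ck_on_SucD: "Ck_on (Suc k) S f \<Longrightarrow> Ck_on k S f"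
proof (induction k arbitrary: f)
  case 0
  then show ?case
    by (simp add: differentiable_imp_continuous_within continuous_at_imp_continuous_on)
next
  case (Suc k)
  then show ?case by (metis Ck_on.simps(2))
qed

lemma Ck_on_has_derivative:
  "Ck_on (Suc k) S f \<Longrightarrow> x \<in> S \<Longrightarrow> (f has_derivative frechet_derivative f (at x)) (at x)"
  by (simp add: frechet_derivative_works)

lemma Ck_on_continuous_on: "Ck_on k S f \<Longrightarrow> continuous_on S f"
  by (induction k) (use Ck_on_SucD in auto)

lemma Ck_on_subset: "Ck_on k S f \<Longrightarrow> T \<subseteq> S \<Longrightarrow> Ck_on k T f"
proof (induction k arbitrary: f)
  case 0
  then show ?case by (auto intro: continuous_on_subset)
qed auto

lemma Ck_on_const: "open S \<Longrightarrow> Ck_on k S (\<lambda>x. c)"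
proof (induction k arbitrary: c)
  case (Suc k)
  then show ?case by (intro Ck_on_SucI[where f'="\<lambda>_ _. 0"]) auto
qed auto

lemma Ck_on_linear: "open S \<Longrightarrow> bounded_linear L \<Longrightarrow> Ck_on k S L"
proof (cases k)
  case (Suc k)
  assume "open S" "bounded_linear L"
  then show ?thesis unfolding Suc
    by (intro Ck_on_SucI[where f'="\<lambda>_. L"]) (auto intro: Ck_on_const bounded_linear_imp_has_derivative)
qed (auto intro: linear_continuous_on)

lemma Ck_on_linear_compose:
  assumes "bounded_linear L" "open S" "Ck_on k S f"
  shows "Ck_on k S (\<lambda>x. L (f x))"
  using assms(3)
proof (induction k arbitrary: f)
  case 0
  then show ?case using bounded_linear.continuous_on[OF assms(1)] by auto
next
  case (Suc k)
  show ?case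
    by (rule Ck_on_SucI[OF assms(2), where f'="\<lambda>x v. L (frechet_derivative f (at x) v)"])
      (use Suc in \<open>auto intro: bounded_linear.has_derivative[OF assms(1)] simp: frechet_derivative_works\<close>)
qed

lemma Ck_on_add:
  assumes "open S" "Ck_on k S f" "Ck_on k S g"
  shows "Ck_on k S (\<lambda>x. f x + g x)"
  using assms(2,3)
proof (induction k arbitrary: f g)
  case 0
  then show ?case by (auto intro: continuous_intros)
next
  case (Suc k)
  show ?case
    by (rule Ck_on_SucI[OF assms(1), where f'="\<lambda>x v. frechet_derivative f (at x) v + frechet_derivative g (at x) v"])
      (use Suc in \<open>auto intro!: has_derivative_add simp: frechet_derivative_works\<close>)
qed

lemma Ck_on_minus:
  assumes "open S" "Ck_on k S f"
  shows "Ck_on k S (\<lambda>x. - f x)"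
  by (rule Ck_on_linear_compose[OF _ assms]) (rule bounded_linear_minus[OF bounded_linear_ident])

lemma Ck_on_diff:
  assumes "open S" "Ck_on k S f" "Ck_on k S g"
  shows "Ck_on k S (\<lambda>x. f x - g x)"
  using Ck_on_add[OF assms(1,2) Ck_on_minus[OF assms(1,3)]] by simp

lemma Ck_on_sum:
  assumes "open S" "\<And>i. i \<in> I \<Longrightarrow> Ck_on k S (f i)"
  shows "Ck_on k S (\<lambda>x. \<Sum>i\<in>I. f i x)"
  using assms(2)
  by (induction I rule: infinite_finite_induct) (auto intro: Ck_on_const Ck_on_add assms(1))

lemma Ck_on_bilinear:
  assumes "bounded_bilinear B" "open S" "Ck_on k S f" "Ck_on k S g"
  shows "Ck_on k S (\<lambda>x. B (f x) (g x))"
  using assms(3,4)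
proof (induction k arbitrary: f g)
  case 0
  then show ?case using bounded_bilinear.continuous_on[OF assms(1)] by auto
next
  case (Suc k)
  note S = Ck_on_SucD[OF Suc.prems(1)] Ck_on_SucD[OF Suc.prems(2)]
  show ?case
    by (rule Ck_on_SucI[OF assms(2), where f'="\<lambda>x v. B (f x) (frechet_derivative g (at x) v) + B (frechet_derivative f (at x) v) (g x)"])
      (use Suc S in \<open>auto intro!: Ck_on_add assms(2) bounded_bilinear.FDERIV[OF assms(1)] simp: frechet_derivative_works\<close>)
qed

lemma Ck_on_Pair:
  assumes "open S" "Ck_on k S f" "Ck_on k S g"
  shows "Ck_on k S (\<lambda>x. (f x, g x))"
proof -
  have "bounded_linear (\<lambda>x. (x, 0))" "bounded_linear (\<lambda>x. (0, x))"
    by (simp_all add: bounded_linear_Pair bounded_linear_ident bounded_linear_zero)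
  from Ck_on_add[OF assms(1) Ck_on_linear_compose[OF this(1) assms(1,2)] Ck_on_linear_compose[OF this(2) assms(1,3)]]
  show ?thesis by simp
qed

lemma linear_eq_sum_Basis:
  fixes L :: "'a::euclidean_space \<Rightarrow> 'b::real_vector"
  assumes "linear L"
  shows "L v = (\<Sum>i\<in>Basis. (v \<bullet> i) *\<^sub>R L i)"
proof -
  have "L v = L (\<Sum>i\<in>Basis. (v \<bullet> i) *\<^sub>R i)"
    by (simp add: euclidean_representation)
  then show ?thesis
    by (simp add: linear_sum[OF assms] linear_cmul[OF assms] del: euclidean_representation)
qed

lemma Ck_on_compose:
  fixes f :: "'a::real_normed_vector \<Rightarrow> 'b::euclidean_space"
  assumes "open S" "open T" "f ` S \<subseteq> T" "Ck_on k S f" "Ck_on k T g"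
  shows "Ck_on k S (\<lambda>x. g (f x))"
  using assms(4,5)
proof (induction k arbitrary: g)
  case 0
  then show ?case using assms(3) by (auto intro: continuous_on_compose2)
next
  case (Suc k)
  let ?f' = "\<lambda>x. frechet_derivative f (at x)" and ?g' = "\<lambda>x. frechet_derivative g (at x)"
  have f: "(f has_derivative ?f' x) (at x)" if "x \<in> S" for x
    using Suc.prems(1) that by (rule Ck_on_has_derivative)
  have g: "(g has_derivative ?g' (f x)) (at (f x))" if "x \<in> S" for x
    using Suc.prems(2) that assms(3) by (intro Ck_on_has_derivative) auto
  have *: "((\<lambda>x. g (f x)) has_derivative (\<lambda>v. \<Sum>i\<in>Basis. (?f' x v \<bullet> i) *\<^sub>R ?g' (f x) i)) (at x)"
    if "x \<in> S" for x
    using has_derivative_compose[OF f[OF that] g[OF that]]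
    by (subst (asm) linear_eq_sum_Basis[OF has_derivative_linear[OF g[OF that]]])
  show ?case
  proof (rule Ck_on_SucI[OF assms(1) *])
    fix v
    show "Ck_on k S (\<lambda>x. \<Sum>i\<in>Basis. (?f' x v \<bullet> i) *\<^sub>R ?g' (f x) i)"
      by (intro Ck_on_sum Ck_on_bilinear[OF bounded_bilinear_scaleR] assms(1) Suc.IH
          Ck_on_linear_compose[OF bounded_linear_inner_left] Ck_on_SucD[OF Suc.prems(1)])
        (use Suc.prems in auto)
  qed auto
qed

lemma has_derivative_bilinear_vanishing:
  assumes "bounded_bilinear B" "isCont h x" "(k has_derivative k') (at x)" "k x = 0"
  shows "((\<lambda>y. B (h y) (k y)) has_derivative (\<lambda>v. B (h x) (k' v))) (at x)"
proof -
  interpret B: bounded_bilinear B by fact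
  obtain K where K: "K > 0" "\<And>a b. norm (B a b) \<le> norm a * norm b * K"
    using B.pos_bounded by blast
  interpret k': bounded_linear k' using assms(3) by (rule has_derivative_bounded_linear)
  obtain C where C: "C > 0" "\<And>v. norm (k' v) \<le> norm v * C"
    using k'.pos_bounded by blast
  show ?thesis
    unfolding has_derivative_within
  proof (intro conjI)
    show "bounded_linear (\<lambda>v. B (h x) (k' v))"
      by (rule bounded_linear_compose[OF B.bounded_linear_right k'.bounded_linear_axioms])
    have lim: "((\<lambda>y. norm (h y) * (norm (k y - k' (y - x)) / norm (y - x)) * K + norm (h y - h x) * C * K) \<longlongrightarrow>
        norm (h x) * 0 * K + norm (h x - h x) * C * K) (at x)"
    proof (intro tendsto_intros)
      show "(h \<longlongrightarrow> h x) (at x)" "(h \<longlongrightarrow> h x) (at x)"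
        using assms(2) by (simp_all add: isCont_def)
      have "((\<lambda>y. (1 / norm (y - x)) *\<^sub>R (k y - (k x + k' (y - x)))) \<longlongrightarrow> 0) (at x)"
        using assms(3) unfolding has_derivative_within by blast
      from tendsto_norm_zero[OF this]
      show "((\<lambda>y. norm (k y - k' (y - x)) / norm (y - x)) \<longlongrightarrow> 0) (at x)"
        using assms(4) by simp
    qed
    show "((\<lambda>y. (1 / norm (y - x)) *\<^sub>R (B (h y) (k y) - (B (h x) (k x) + B (h x) (k' (y - x))))) \<longlongrightarrow> 0) (at x)"
    proof (rule Lim_null_comparison)
      show "\<forall>\<^sub>F y in at x. norm ((1 / norm (y - x)) *\<^sub>R (B (h y) (k y) - (B (h x) (k x) + B (h x) (k' (y - x)))))
          \<le> norm (h y) * (norm (k y - k' (y - x)) / norm (y - x)) * K + norm (h y - h x) * C * K"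
      proof (rule eventually_mono[OF eventually_neq_at_within[of x]])
        fix y assume "y \<noteq> x"
        then have pos: "norm (y - x) > 0" by simp
        have "B (h y) (k y) - (B (h x) (k x) + B (h x) (k' (y - x)))
            = B (h y) (k y - k' (y - x)) + B (h y - h x) (k' (y - x))"
          by (simp add: B.diff_left B.diff_right assms(4) B.zero_right)
        also have "norm \<dots> \<le> norm (h y) * norm (k y - k' (y - x)) * K + norm (h y - h x) * (norm (y - x) * C) * K"
        proof (rule norm_triangle_le[OF add_mono[OF K(2) order_trans[OF K(2)]]])
          show "norm (h y - h x) * norm (k' (y - x)) * K \<le> norm (h y - h x) * (norm (y - x) * C) * K"
            using C K by (intro mult_right_mono mult_left_mono) auto
        qed
        also have "\<dots> = norm (y - x) * (norm (h y) * (norm (k y - k' (y - x)) / norm (y - x)) * K + norm (h y - h x) * C * K)"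
          using pos by (simp add: field_simps)
        finally show "norm ((1 / norm (y - x)) *\<^sub>R (B (h y) (k y) - (B (h x) (k x) + B (h x) (k' (y - x)))))
          \<le> norm (h y) * (norm (k y - k' (y - x)) / norm (y - x)) * K + norm (h y - h x) * C * K"
          using pos by (simp add: divide_le_eq mult.commute)
      qed
    qed (use lim in simp)
  qed
qed

lemma blinfun_inverse_diff_eq:
  fixes A B :: "'b::real_normed_vector \<Rightarrow>\<^sub>L 'c::real_normed_vector"
  assumes "Q o\<^sub>L B = id_blinfun" "A o\<^sub>L P = id_blinfun"
  shows "Q = P - (Q o\<^sub>L (B - A) o\<^sub>L P)"
proof (rule blinfun_eqI)
  fix v
  have "Q (B w) = w" "A (P w') = w'" for w w'
    using assms by (metis blinfun_apply_blinfun_compose blinfun_apply_id_blinfun)+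
  then show "Q v = (P - (Q o\<^sub>L (B - A) o\<^sub>L P)) v"
    by (simp add: blinfun.diff_left blinfun.diff_right)
qed

lemma blinfun_inverse_isCont:
  fixes M :: "'a::real_normed_vector \<Rightarrow> 'b::real_normed_vector \<Rightarrow>\<^sub>L 'c::real_normed_vector"
  assumes "open S" "x \<in> S" "isCont M x"
    and RM: "\<And>y. y \<in> S \<Longrightarrow> R y o\<^sub>L M y = id_blinfun"
    and MR: "\<And>y. y \<in> S \<Longrightarrow> M y o\<^sub>L R y = id_blinfun"
  shows "isCont R x"
proof -
  note eq = blinfun_inverse_diff_eq[OF RM MR[OF assms(2)]]
  have contM: "(M \<longlongrightarrow> M x) (at x)"
    using assms(3) by (simp add: isCont_def)
  have evS: "\<forall>\<^sub>F y in at x. y \<in> S"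
    using assms(1,2) by (rule eventually_at_in_open')
  have lim0: "((\<lambda>y. norm (M y - M x) * norm (R x)) \<longlongrightarrow> 0) (at x)"
    by (rule tendsto_eq_intros contM refl | simp)+
  have ev2: "\<forall>\<^sub>F y in at x. norm (M y - M x) * norm (R x) < 1 / 2"
    using order_tendstoD(2)[OF lim0, of "1/2"] by simp
  have bnd: "\<forall>\<^sub>F y in at x. norm (R y - R x) \<le> 2 * norm (R x) * (norm (M y - M x) * norm (R x))"
    using evS ev2
  proof eventually_elim
    case y: (elim y)
    have le: "norm (R y - R x) \<le> norm (R y) * (norm (M y - M x) * norm (R x))"
    proof -
      have "norm (R y - R x) = norm (R y o\<^sub>L (M y - M x) o\<^sub>L R x)"
        by (subst eq[OF y(1)]) (simp add: norm_minus_commute)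
      also have "\<dots> \<le> norm (R y o\<^sub>L (M y - M x)) * norm (R x)"
        by (rule norm_blinfun_compose)
      also have "\<dots> \<le> (norm (R y) * norm (M y - M x)) * norm (R x)"
        by (intro mult_right_mono norm_blinfun_compose) auto
      finally show ?thesis by (simp add: mult.assoc)
    qed
    also have "\<dots> \<le> norm (R y) * (1/2)"
      using y by (intro mult_left_mono) auto
    finally have "norm (R y - R x) \<le> norm (R y) / 2" by simp
    then have "norm (R y) \<le> 2 * norm (R x)"
      using norm_triangle_ineq2[of "R y" "R x"] by simp
    then have "norm (R y) * (norm (M y - M x) * norm (R x)) \<le> 2 * norm (R x) * (norm (M y - M x) * norm (R x))"
      by (rule mult_right_mono) simp
    then show "norm (R y - R x) \<le> 2 * norm (R x) * (norm (M y - M x) * norm (R x))"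
      using le by (rule order_trans[rotated])
  qed
  have "((\<lambda>y. R y - R x) \<longlongrightarrow> 0) (at x)"
    by (rule Lim_null_comparison[OF bnd]) (rule tendsto_mult_right_zero[OF lim0])
  then show ?thesis
    unfolding isCont_def by (rule LIM_zero_cancel)
qed

lemma blinfun_inverse_has_derivative:
  fixes M :: "'a::real_normed_vector \<Rightarrow> 'b::real_normed_vector \<Rightarrow>\<^sub>L 'c::real_normed_vector"
  assumes "open S" "x \<in> S" "(M has_derivative M') (at x)"
    and RM: "\<And>y. y \<in> S \<Longrightarrow> R y o\<^sub>L M y = id_blinfun"
    and MR: "\<And>y. y \<in> S \<Longrightarrow> M y o\<^sub>L R y = id_blinfun"
  shows "(R has_derivative (\<lambda>v. - (R x o\<^sub>L M' v o\<^sub>L R x))) (at x)"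
proof -
  note eq = blinfun_inverse_diff_eq[OF RM MR[OF assms(2)]]
  have cont: "isCont R x"
    using assms(1,2) has_derivative_continuous[OF assms(3)] RM MR by (rule blinfun_inverse_isCont)
  have "((\<lambda>y. M y - M x) has_derivative M') (at x)"
    using has_derivative_diff[OF assms(3) has_derivative_const[of "M x"]] by simp
  then have "((\<lambda>y. R y o\<^sub>L (M y - M x)) has_derivative (\<lambda>v. R x o\<^sub>L M' v)) (at x)"
    by (intro has_derivative_bilinear_vanishing[OF bounded_bilinear_blinfun_compose cont]) simp_all
  from has_derivative_diff[OF has_derivative_const[of "R x"]
      bounded_linear.has_derivative[OF bounded_bilinear.bounded_linear_left[OF bounded_bilinear_blinfun_compose] this]]
  have der: "((\<lambda>y. R x - ((R y o\<^sub>L (M y - M x)) o\<^sub>L R x)) has_derivative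
      (\<lambda>v. 0 - (R x o\<^sub>L M' v o\<^sub>L R x))) (at x)" .
  show ?thesis
    using has_derivative_transform_within_open[OF der assms(1,2) eq[symmetric]] by simp
qed

lemma Ck_on_blinfun_inverse:
  fixes M :: "'a::real_normed_vector \<Rightarrow> 'b::real_normed_vector \<Rightarrow>\<^sub>L 'c::real_normed_vector"
  assumes "open S" "Ck_on k S M"
    and RM: "\<And>y. y \<in> S \<Longrightarrow> R y o\<^sub>L M y = id_blinfun"
    and MR: "\<And>y. y \<in> S \<Longrightarrow> M y o\<^sub>L R y = id_blinfun"
  shows "Ck_on k S R"
  using assms(2)
proof (induction k)
  case 0
  then show ?case
    using blinfun_inverse_isCont[OF assms(1) _ _ RM MR] assms(1)
    by (simp add: continuous_on_eq_continuous_at)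
next
  case (Suc k)
  have der: "(R has_derivative (\<lambda>v. - (R x o\<^sub>L frechet_derivative M (at x) v o\<^sub>L R x))) (at x)" if "x \<in> S" for x
    using Suc.prems that by (intro blinfun_inverse_has_derivative[OF assms(1) that _ RM MR] Ck_on_has_derivative)
  note R = Suc.IH[OF Ck_on_SucD[OF Suc.prems]]
  show ?case
    by (rule Ck_on_SucI[OF assms(1) der])
      (use Suc.prems R in \<open>auto intro!: Ck_on_minus Ck_on_bilinear[OF bounded_bilinear_blinfun_compose] assms(1)\<close>)
qed

subsection \<open>Smooth inverse functions\<close>

lemma injective_linear_blinfun_inverse:
  fixes L :: "'a::euclidean_space \<Rightarrow>\<^sub>L 'a"
  assumes "\<And>v. L v = 0 \<Longrightarrow> v = 0"
  obtains R where "R o\<^sub>L L = id_blinfun"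
proof -
  have lin: "linear (blinfun_apply L)"
    by (simp add: blinfun.bounded_linear_right bounded_linear.linear)
  have "inj (blinfun_apply L)"
    using assms by (simp add: linear_injective_0[OF lin])
  then obtain g where g: "linear g" "g \<circ> blinfun_apply L = id"
    using linear_injective_left_inverse[OF lin] by blast
  have "Blinfun g o\<^sub>L L = id_blinfun"
  proof (rule blinfun_eqI)
    fix v
    show "(Blinfun g o\<^sub>L L) v = id_blinfun v"
      using g(2) by (simp add: bounded_linear_Blinfun_apply[OF linear_conv_bounded_linear[THEN iffD1, OF g(1)]] fun_eq_iff)
  qed
  then show thesis by (rule that)
qed

lemma smooth_onD: "smooth_on S f \<Longrightarrow> Ck_on k S f"
  by (simp add: smooth_on_def)

lemma smooth_on_has_derivative:
  "smooth_on S f \<Longrightarrow> x \<in> S \<Longrightarrow> (f has_derivative frechet_derivative f (at x)) (at x)"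
  by (rule Ck_on_has_derivative[OF smooth_onD[where k="Suc 0"]])

lemma smooth_on_partial: "smooth_on S f \<Longrightarrow> smooth_on S (\<lambda>x. frechet_derivative f (at x) v)"
  unfolding smooth_on_def by (metis Ck_on.simps(2))

lemma smooth_on_derivative_blinfun:
  fixes f :: "'a::euclidean_space \<Rightarrow> 'b::real_normed_vector"
  assumes "open S" "smooth_on S f"
  obtains f' where "\<And>x. x \<in> S \<Longrightarrow> (f has_derivative blinfun_apply (f' x)) (at x)" "smooth_on S f'"
proof
  let ?f' = "\<lambda>x. \<Sum>i\<in>Basis. blinfun_scaleR_left (frechet_derivative f (at x) i) o\<^sub>L blinfun_inner_left i"
  show "(f has_derivative blinfun_apply (?f' x)) (at x)" if "x \<in> S" for x
  proof -
    have "blinfun_apply (?f' x) v = frechet_derivative f (at x) v" for v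
      by (subst linear_eq_sum_Basis[OF has_derivative_linear[OF smooth_on_has_derivative[OF assms(2) that]]])
        (simp add: blinfun.sum_left blinfun_inner_left.rep_eq)
    then have "blinfun_apply (?f' x) = frechet_derivative f (at x)" ..
    then show ?thesis
      using smooth_on_has_derivative[OF assms(2) that] by simp
  qed
  show "smooth_on S ?f'"
    unfolding smooth_on_def
    by (intro allI Ck_on_sum Ck_on_linear_compose[OF bounded_bilinear.bounded_linear_left[OF bounded_bilinear_blinfun_compose]]
        Ck_on_linear_compose[OF bounded_linear_blinfun_scaleR_left] assms(1) smooth_onD smooth_on_partial assms(2))
qed

lemma smooth_on_subset: "smooth_on S f \<Longrightarrow> T \<subseteq> S \<Longrightarrow> smooth_on T f"
  unfolding smooth_on_def using Ck_on_subset by blast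

lemma smooth_on_compose:
  fixes f :: "'a::real_normed_vector \<Rightarrow> 'b::euclidean_space"
  assumes "open S" "open T" "f ` S \<subseteq> T" "smooth_on S f" "smooth_on T g"
  shows "smooth_on S (\<lambda>x. g (f x))"
  using assms Ck_on_compose unfolding smooth_on_def by blast

lemma smooth_inverse_function:
  fixes f :: "'a::euclidean_space \<Rightarrow> 'a"
  assumes "open S" "smooth_on S f" "x0 \<in> S"
    and inj: "\<And>v. frechet_derivative f (at x0) v = 0 \<Longrightarrow> v = 0"
  obtains U where "U \<subseteq> S" "x0 \<in> U" "diffeomorphism_onto_image U f"
proof -
  obtain f' where f': "\<And>x. x \<in> S \<Longrightarrow> (f has_derivative blinfun_apply (f' x)) (at x)" "smooth_on S f'"
    using smooth_on_derivative_blinfun[OF assms(1,2)] by blast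
  have "f' x0 v = 0 \<Longrightarrow> v = 0" for v
    using inj frechet_derivative_at[OF f'(1)[OF assms(3)]] by simp
  then obtain R where R: "R o\<^sub>L f' x0 = id_blinfun"
    using injective_linear_blinfun_inverse by blast
  have contf': "continuous_on S f'"
    using Ck_on_continuous_on[OF smooth_onD[OF f'(2), of 0]] .
  obtain U V g g' where UV: "open U" "U \<subseteq> S" "x0 \<in> U" "open V" "homeomorphism U V f g"
    and g: "\<And>y. y \<in> V \<Longrightarrow> (g has_derivative (g' y)) (at y)"
    "\<And>y. y \<in> V \<Longrightarrow> g' y = inv (blinfun_apply (f'(g y)))"
    "\<And>y. y \<in> V \<Longrightarrow> bij (blinfun_apply (f'(g y)))"
    using inverse_function_theorem[OF assms(1) f'(1) contf' assms(3) R] by metis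
  have img: "f ` U = V" "g ` V = U" and gf: "\<And>x. x \<in> U \<Longrightarrow> g (f x) = x" "\<And>y. y \<in> V \<Longrightarrow> f (g y) = y"
    using UV(5) by (auto simp: homeomorphism_def)
  have injU: "inj_on f U"
    using gf(1) by (rule inj_on_inverseI)
  let ?R = "\<lambda>y. Blinfun (g' y)"
  have app: "blinfun_apply (?R y) = g' y" if "y \<in> V" for y
    using g(1)[OF that] by (intro bounded_linear_Blinfun_apply has_derivative_bounded_linear)
  have inverse: "?R y o\<^sub>L f' (g y) = id_blinfun" "f' (g y) o\<^sub>L ?R y = id_blinfun" if "y \<in> V" for y
    using g(3)[OF that] by (auto intro!: blinfun_eqI simp: app[OF that, unfolded g(2)[OF that]] g(2)[OF that] bij_is_inj bij_is_surj surj_f_inv_f)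
  have "Ck_on k V g" for k
  proof (induction k)
    case 0
    then show ?case
      using UV(5) by (simp add: homeomorphism_def)
  next
    case (Suc k)
    have "Ck_on k V (\<lambda>y. f' (g y))"
      using img UV smooth_onD[OF f'(2)] by (intro Ck_on_compose[OF UV(4) assms(1) _ Suc]) auto
    then have "Ck_on k V ?R"
      by (rule Ck_on_blinfun_inverse[OF UV(4)]) (use inverse in auto)
    then have "Ck_on k V (\<lambda>y. ?R y v)" for v
      by (rule Ck_on_linear_compose[OF blinfun.bounded_linear_left UV(4)])
    then show ?case
      using g(1) by (intro Ck_on_SucI[OF UV(4), where f'="\<lambda>y. blinfun_apply (?R y)"]) (simp_all add: app)
  qed
  moreover have "g y = the_inv_into U f y" if "y \<in> V" for y
    using that img gf the_inv_into_f_f[OF injU] by (metis imageE)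
  ultimately have "Ck_on k V (the_inv_into U f)" for k
    by (metis Ck_on_cong[OF UV(4)])
  then have "diffeomorphism_onto_image U f"
    using UV injU img Ck_on_subset smooth_onD[OF assms(2)]
    unfolding diffeomorphism_onto_image_def smooth_on_def by blast
  with UV(2,3) show thesis by (rule that)
qed

subsection \<open>Symmetry of second derivatives\<close>

lemma has_real_derivative_directional:
  assumes "(f has_derivative f') (at (z + a *\<^sub>R v + w))"
  shows "((\<lambda>s. f (z + s *\<^sub>R v + w)) has_real_derivative f' v) (at a)"
proof -
  interpret f': bounded_linear f' using assms by (rule has_derivative_bounded_linear)
  have "((\<lambda>s. z + s *\<^sub>R v + w) has_derivative (\<lambda>s. s *\<^sub>R v)) (at a)"
    by (auto intro!: derivative_eq_intros)
  from has_derivative_compose[OF this assms] show ?thesis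
    by (simp add: has_field_derivative_def f'.scaleR mult.commute[of _ "f' v"])
qed

text \<open>Schwarz: by the mean value theorem, applied twice, the second difference along
  \<open>h u\<close>, \<open>h v\<close> is \<open>h\<^sup>2\<close> times either mixed derivative at nearby points.\<close>

lemma second_difference_mean_value:
  fixes p :: "'a::real_normed_vector \<Rightarrow> real"
  assumes "Ck_on (Suc (Suc 0)) UNIV p" "h > 0"
  obtains a b where "0 < a" "a < h" "0 < b" "b < h"
    "p (z + h *\<^sub>R u + h *\<^sub>R v) - p (z + h *\<^sub>R u) - p (z + h *\<^sub>R v) + p z
     = h * h * frechet_derivative (\<lambda>x. frechet_derivative p (at x) u) (at (z + a *\<^sub>R u + b *\<^sub>R v)) v"
proof -
  let ?p' = "\<lambda>x. frechet_derivative p (at x)"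
  let ?p'' = "\<lambda>x. frechet_derivative (\<lambda>x. ?p' x u) (at x)"
  have p: "(p has_derivative ?p' x) (at x)" "((\<lambda>x. ?p' x u) has_derivative ?p'' x) (at x)" for x
    using assms(1) by (simp_all add: frechet_derivative_works[symmetric])
  let ?g = "\<lambda>s. p (z + s *\<^sub>R u + h *\<^sub>R v) - p (z + s *\<^sub>R u)"
  have "(?g has_real_derivative (?p' (z + s *\<^sub>R u + h *\<^sub>R v) u - ?p' (z + s *\<^sub>R u) u)) (at s)" for s
    using has_real_derivative_directional[OF p(1)[of "z + s *\<^sub>R u + h *\<^sub>R v"]]
      has_real_derivative_directional[of p _ z s u 0, OF p(1)]
    by (intro DERIV_diff) simp_all
  from MVT2[OF assms(2) this] obtain a where a: "0 < a" "a < h"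
    "?g h - ?g 0 = (h - 0) * (?p' (z + a *\<^sub>R u + h *\<^sub>R v) u - ?p' (z + a *\<^sub>R u) u)"
    by blast
  have "((\<lambda>t. ?p' (z + a *\<^sub>R u + t *\<^sub>R v) u) has_real_derivative ?p'' (z + a *\<^sub>R u + t *\<^sub>R v) v) (at t)" for t
    using has_real_derivative_directional[of "\<lambda>x. ?p' x u" _ "z + a *\<^sub>R u" t v 0, OF p(2)] by simp
  from MVT2[OF assms(2) this] obtain b where b: "0 < b" "b < h"
    "?p' (z + a *\<^sub>R u + h *\<^sub>R v) u - ?p' (z + a *\<^sub>R u + 0 *\<^sub>R v) u = (h - 0) * ?p'' (z + a *\<^sub>R u + b *\<^sub>R v) v"
    by blast
  show thesis
    using a b by (intro that[of a b]) simp_all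
qed

lemma mixed_derivatives_commute:
  fixes p :: "'a::real_normed_vector \<Rightarrow> real"
  assumes "Ck_on (Suc (Suc 0)) UNIV p"
  shows "frechet_derivative (\<lambda>x. frechet_derivative p (at x) u) (at z) v
       = frechet_derivative (\<lambda>x. frechet_derivative p (at x) v) (at z) u"
proof -
  define D where "D u v x = frechet_derivative (\<lambda>x. frechet_derivative p (at x) u) (at x) v" for u v x
  define \<Delta> where "\<Delta> u v h = (p (z + h *\<^sub>R u + h *\<^sub>R v) - p (z + h *\<^sub>R u) - p (z + h *\<^sub>R v) + p z) / (h * h)" for u v h
  have lim: "(\<Delta> u v \<longlongrightarrow> D u v z) (at_right 0)" for u v
  proof -
    have "\<forall>h. \<exists>a b. h > 0 \<longrightarrow> 0 < a \<and> a < h \<and> 0 < b \<and> b < h \<and> \<Delta> u v h = D u v (z + a *\<^sub>R u + b *\<^sub>R v)"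
    proof
      fix h
      show "\<exists>a b. h > 0 \<longrightarrow> 0 < a \<and> a < h \<and> 0 < b \<and> b < h \<and> \<Delta> u v h = D u v (z + a *\<^sub>R u + b *\<^sub>R v)"
      proof (cases "h > 0")
        case True
        obtain a b where "0 < a" "a < h" "0 < b" "b < h"
          "p (z + h *\<^sub>R u + h *\<^sub>R v) - p (z + h *\<^sub>R u) - p (z + h *\<^sub>R v) + p z
            = h * h * D u v (z + a *\<^sub>R u + b *\<^sub>R v)"
          using second_difference_mean_value[OF assms True, of z u v] unfolding D_def by metis
        then show ?thesis
          using True by (intro exI[of _ a] exI[of _ b]) (simp add: \<Delta>_def)
      qed auto
    qed
    then obtain a b where ab: "\<And>h. h > 0 \<Longrightarrow> 0 < a h \<and> a h < h \<and> 0 < b h \<and> b h < h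
        \<and> \<Delta> u v h = D u v (z + a h *\<^sub>R u + b h *\<^sub>R v)"
      by metis
    have small: "(c \<longlongrightarrow> 0) (at_right 0)" if "\<And>h. h > 0 \<Longrightarrow> 0 < c h \<and> c h < h" for c :: "real \<Rightarrow> real"
    proof (rule tendsto_sandwich[of "\<lambda>_. 0" c _ "\<lambda>h. h"])
      show "\<forall>\<^sub>F h in at_right 0. 0 \<le> c h" "\<forall>\<^sub>F h in at_right 0. c h \<le> h"
        using that by (auto simp: eventually_at_right_field intro!: exI[of _ 1] less_imp_le)
    qed auto
    have "((\<lambda>h. z + a h *\<^sub>R u + b h *\<^sub>R v) \<longlongrightarrow> z + 0 *\<^sub>R u + 0 *\<^sub>R v) (at_right 0)"
      using ab by (intro tendsto_intros small) auto
    moreover have "isCont (D u v) z"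
      using assms unfolding D_def by (simp add: continuous_on_eq_continuous_at)
    ultimately have "((\<lambda>h. D u v (z + a h *\<^sub>R u + b h *\<^sub>R v)) \<longlongrightarrow> D u v z) (at_right 0)"
      by (intro isCont_tendsto_compose[of z "D u v"]) simp_all
    then show ?thesis
      by (rule Lim_transform_eventually) (use ab in \<open>auto simp: eventually_at_right_field intro!: exI[of _ 1]\<close>)
  qed
  have "\<Delta> u v = \<Delta> v u"
    by (auto simp: \<Delta>_def fun_eq_iff add_ac)
  then have "D u v z = D v u z"
    using tendsto_unique[OF _ lim[of u v], of "D v u z"] lim[of v u] by simp
  then show ?thesis by (simp add: D_def)
qed

subsection \<open>Superposition and integration of bounded curves\<close>

instance bcontfun :: (metric_space, banach) banach ..

lemma uniformly_continuous_near_bounded: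
  fixes F :: "'a::heine_borel \<Rightarrow> 'b::metric_space"
  assumes "continuous_on UNIV F" "bounded A" "e > 0"
  obtains d where "d > 0" "\<And>a b. a \<in> A \<Longrightarrow> dist b a < d \<Longrightarrow> dist (F b) (F a) < e"
proof -
  obtain c r where A: "A \<subseteq> cball c r"
    using assms(2) bounded_subset_cball by blast
  have "uniformly_continuous_on (cball c (r + 1)) F"
    using assms(1) by (intro compact_uniformly_continuous continuous_on_subset[OF assms(1)]) auto
  then obtain d where d: "d > 0" "\<And>a b. a \<in> cball c (r + 1) \<Longrightarrow> b \<in> cball c (r + 1) \<Longrightarrow> dist b a < d \<Longrightarrow> dist (F b) (F a) < e"
    using assms(3) unfolding uniformly_continuous_on_def by metis
  show thesis
  proof (rule that[of "min d 1"])
    fix a b assume ab: "a \<in> A" "dist b a < min d 1"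
    then have "dist c a \<le> r" "dist a b < 1"
      using A by (auto simp: dist_commute)
    then show "dist (F b) (F a) < e"
      using ab d(2)[of a b] dist_triangle[of c b a] by simp
  qed (use d in simp)
qed

text \<open>\<open>Bcontfun\<close> is only meaningful on bounded continuous functions; here this is guaranteed for
  continuous \<open>F\<close>, since the range of a bounded curve is relatively compact.\<close>

definition superpose :: "('a::metric_space \<Rightarrow> 'b::metric_space) \<Rightarrow> ('t::topological_space \<Rightarrow>\<^sub>C 'a) \<Rightarrow> 't \<Rightarrow>\<^sub>C 'b"
  where "superpose F \<gamma> = Bcontfun (\<lambda>\<tau>. F (\<gamma> \<tau>))"

lemma apply_superpose:
  fixes F :: "'a::heine_borel \<Rightarrow> 'b::metric_space"
  assumes "continuous_on UNIV F"
  shows "superpose F \<gamma> \<tau> = F (\<gamma> \<tau>)"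
proof -
  have "compact (closure (range \<gamma>))"
    by (simp add: compact_closure)
  then have "bounded (F ` closure (range \<gamma>))"
    using assms by (intro compact_imp_bounded compact_continuous_image) (auto intro: continuous_on_subset)
  then have "bounded (range (\<lambda>\<tau>. F (\<gamma> \<tau>)))"
    by (rule bounded_subset) (use closure_subset in fastforce)
  moreover have "continuous_on UNIV (\<lambda>\<tau>. F (\<gamma> \<tau>))"
    by (rule continuous_on_compose2[OF assms]) auto
  ultimately show ?thesis
    unfolding superpose_def by (subst Bcontfun_inverse) (auto simp: bcontfun_def)
qed

lemma isCont_superpose:
  fixes F :: "'a::heine_borel \<Rightarrow> 'b::metric_space"
  assumes "continuous_on UNIV F"
  shows "isCont (superpose F) \<gamma>"
  unfolding continuous_at_eps_delta
proof (intro allI impI)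
  fix e :: real assume "e > 0"
  then obtain d where d: "d > 0" "\<And>a b. a \<in> range \<gamma> \<Longrightarrow> dist b a < d \<Longrightarrow> dist (F b) (F a) < e / 2"
    using uniformly_continuous_near_bounded[OF assms bounded_apply_bcontfun] by (metis half_gt_zero)
  have "dist (superpose F \<eta>) (superpose F \<gamma>) < e" if "dist \<eta> \<gamma> < d" for \<eta>
  proof -
    have "dist (superpose F \<eta>) (superpose F \<gamma>) \<le> e / 2"
      using d(2) dist_fun_lt_imp_dist_val_lt[OF that]
      by (intro dist_bound) (simp add: apply_superpose[OF assms] less_imp_le)
    then show ?thesis using \<open>e > 0\<close> by simp
  qed
  then show "\<exists>d>0. \<forall>\<eta>. dist \<eta> \<gamma> < d \<longrightarrow> dist (superpose F \<eta>) (superpose F \<gamma>) < e"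
    using d(1) by blast
qed

definition coeff_mult :: "'a \<Rightarrow> ('t::topological_space \<Rightarrow>\<^sub>C 'a::euclidean_space) \<Rightarrow> ('t \<Rightarrow>\<^sub>C 'b::real_normed_vector) \<Rightarrow> 't \<Rightarrow>\<^sub>C 'b"
  where "coeff_mult i \<eta> \<gamma> = Bcontfun (\<lambda>\<tau>. (\<eta> \<tau> \<bullet> i) *\<^sub>R \<gamma> \<tau>)"

lemma apply_coeff_mult: "coeff_mult i \<eta> \<gamma> \<tau> = (\<eta> \<tau> \<bullet> i) *\<^sub>R \<gamma> \<tau>"
proof -
  have "norm ((\<eta> \<tau> \<bullet> i) *\<^sub>R \<gamma> \<tau>) \<le> (norm \<eta> * norm i) * norm \<gamma>" for \<tau>
  proof -
    have "norm (\<eta> \<tau>) * norm i * norm (\<gamma> \<tau>) \<le> (norm \<eta> * norm i) * norm \<gamma>"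
      by (intro mult_mono norm_bounded order_refl) auto
    moreover have "\<bar>\<eta> \<tau> \<bullet> i\<bar> * norm (\<gamma> \<tau>) \<le> norm (\<eta> \<tau>) * norm i * norm (\<gamma> \<tau>)"
      by (intro mult_right_mono Cauchy_Schwarz_ineq2) auto
    ultimately show ?thesis by simp
  qed
  then have "(\<lambda>\<tau>. (\<eta> \<tau> \<bullet> i) *\<^sub>R \<gamma> \<tau>) \<in> bcontfun"
    by (intro bcontfun_normI continuous_intros) auto
  then show ?thesis
    unfolding coeff_mult_def by (subst Bcontfun_inverse) auto
qed

lemma bounded_bilinear_coeff_mult:
  "bounded_bilinear (coeff_mult i :: ('t::topological_space \<Rightarrow>\<^sub>C 'a::euclidean_space) \<Rightarrow> ('t \<Rightarrow>\<^sub>C 'b::real_normed_vector) \<Rightarrow> _)"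
proof
  have "norm (coeff_mult i a b) \<le> norm a * norm b * norm i"
    for a :: "'t \<Rightarrow>\<^sub>C 'a" and b :: "'t \<Rightarrow>\<^sub>C 'b"
  proof (rule norm_bound)
    fix \<tau>
    have "norm (coeff_mult i a b \<tau>) \<le> norm (a \<tau>) * norm i * norm (b \<tau>)"
      unfolding apply_coeff_mult norm_scaleR by (intro mult_right_mono) (auto intro: Cauchy_Schwarz_ineq2)
    also have "\<dots> \<le> (norm a * norm i) * norm b"
      by (intro mult_mono norm_bounded order_refl) auto
    finally show "norm (coeff_mult i a b \<tau>) \<le> norm a * norm b * norm i"
      by (simp add: ac_simps)
  qed
  then show "\<exists>K. \<forall>a b. norm (coeff_mult i a b :: 't \<Rightarrow>\<^sub>C 'b) \<le> norm a * norm b * K"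
    by blast
qed (auto intro!: bcontfun_eqI simp: apply_coeff_mult algebra_simps)

lemma apply_bcontfun_sum: "(\<Sum>i\<in>I. f i) \<tau> = (\<Sum>i\<in>I. f i \<tau>)"
  for f :: "'i \<Rightarrow> 't::topological_space \<Rightarrow>\<^sub>C 'a::real_normed_vector"
  by (induction I rule: infinite_finite_induct) auto

lemma superpose_has_derivative:
  fixes F :: "'a::euclidean_space \<Rightarrow> 'b::real_normed_vector"
  assumes F': "\<And>x. (F has_derivative F' x) (at x)" and cont: "\<And>v. continuous_on UNIV (\<lambda>x. F' x v)"
  shows "(superpose F has_derivative (\<lambda>\<eta>. \<Sum>i\<in>Basis. coeff_mult i \<eta> (superpose (\<lambda>x. F' x i) \<gamma>))) (at \<gamma>)"
  unfolding has_derivative_at_alt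
proof (intro conjI allI impI)
  show "bounded_linear (\<lambda>\<eta>. \<Sum>i\<in>Basis. coeff_mult i \<eta> (superpose (\<lambda>x. F' x i) \<gamma>))"
    by (intro bounded_linear_sum bounded_bilinear.bounded_linear_left[OF bounded_bilinear_coeff_mult])
  have contF: "continuous_on UNIV F"
    using has_derivative_continuous[OF F'] by (simp add: continuous_at_imp_continuous_on)
  fix e :: real assume e: "e > 0"
  define n where "n = real DIM('a)"
  have n: "n > 0" by (simp add: n_def)
  have "\<exists>d>0. \<forall>a b. a \<in> range \<gamma> \<longrightarrow> dist b a < d \<longrightarrow> dist (F' b i) (F' a i) < e / n" for i
    using uniformly_continuous_near_bounded[OF cont[of i] bounded_apply_bcontfun[of \<gamma>], of "e / n"] e n
    by (metis divide_pos_pos)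
  then obtain D where D: "\<And>i. D i > 0" "\<And>i a b. a \<in> range \<gamma> \<Longrightarrow> dist b a < D i \<Longrightarrow> dist (F' b i) (F' a i) < e / n"
    by metis
  define d where "d = Min (D ` Basis)"
  have d: "d > 0" "\<And>i. i \<in> Basis \<Longrightarrow> d \<le> D i"
    using D(1) by (auto simp: d_def)
  have est: "norm (F b - F a - F' a (b - a)) \<le> e * norm (b - a)" if a: "a \<in> range \<gamma>" and b: "dist b a < d" for a b
  proof -
    have "norm (F b - F a - F' a (b - a)) \<le> norm (b - a) * e"
    proof (rule differentiable_bound_linearization[where S="ball a d" and f'=F'])
      show "a + t *\<^sub>R (b - a) \<in> ball a d" if "t \<in> {0..1}" for t
      proof -
        have "norm (t *\<^sub>R (b - a)) \<le> norm (b - a)"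
          using that by (simp add: mult_left_le_one_le)
        then show ?thesis using b by (simp add: dist_norm norm_minus_commute)
      qed
      show "(F has_derivative F' x) (at x within ball a d)" for x
        using F' by (rule has_derivative_at_withinI)
      show "onorm (F' x - F' a) \<le> e" if x: "x \<in> ball a d" for x
      proof (rule onorm_le)
        fix v
        have lin: "linear (\<lambda>v. F' x v - F' a v)"
          by (intro linear_compose_sub has_derivative_linear[OF F'])
        have "norm (F' x v - F' a v) \<le> (\<Sum>i\<in>Basis. norm ((v \<bullet> i) *\<^sub>R (F' x i - F' a i)))"
          by (subst linear_eq_sum_Basis[OF lin]) (rule norm_sum)
        also have "\<dots> \<le> (\<Sum>i\<in>(Basis::'a set). norm v * (e / n))"
        proof (rule sum_mono)
          fix i :: 'a assume i: "i \<in> Basis"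
          have "dist (F' x i) (F' a i) < e / n"
            using D(2)[OF a, of x i] d(2)[OF i] x by (simp add: dist_commute)
          then show "norm ((v \<bullet> i) *\<^sub>R (F' x i - F' a i)) \<le> norm v * (e / n)"
            using i e n unfolding norm_scaleR dist_norm
            by (intro mult_mono) (auto simp: Basis_le_norm)
        qed
        also have "\<dots> = e * norm v"
          using n by (simp add: n_def)
        finally show "norm ((F' x - F' a) v) \<le> e * norm v" by simp
      qed
    qed (use d in auto)
    then show ?thesis by (simp add: mult.commute)
  qed
  have "norm (superpose F \<eta> - superpose F \<gamma> - (\<Sum>i\<in>Basis. coeff_mult i (\<eta> - \<gamma>) (superpose (\<lambda>x. F' x i) \<gamma>)))
      \<le> e * norm (\<eta> - \<gamma>)" if \<eta>: "norm (\<eta> - \<gamma>) < d" for \<eta>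
  proof (rule norm_bound)
    fix \<tau>
    have *: "dist (\<eta> \<tau>) (\<gamma> \<tau>) < d"
      using \<eta> by (intro dist_fun_lt_imp_dist_val_lt) (simp add: dist_norm)
    have "(superpose F \<eta> - superpose F \<gamma> - (\<Sum>i\<in>Basis. coeff_mult i (\<eta> - \<gamma>) (superpose (\<lambda>x. F' x i) \<gamma>))) \<tau>
        = F (\<eta> \<tau>) - F (\<gamma> \<tau>) - (\<Sum>i\<in>Basis. ((\<eta> \<tau> - \<gamma> \<tau>) \<bullet> i) *\<^sub>R F' (\<gamma> \<tau>) i)"
      by (simp add: apply_bcontfun_sum apply_coeff_mult apply_superpose contF cont)
    also have "\<dots> = F (\<eta> \<tau>) - F (\<gamma> \<tau>) - F' (\<gamma> \<tau>) (\<eta> \<tau> - \<gamma> \<tau>)"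
      by (subst (2) linear_eq_sum_Basis[OF has_derivative_linear[OF F']]) simp
    also have "norm \<dots> \<le> e * norm (\<eta> \<tau> - \<gamma> \<tau>)"
      using est * by blast
    also have "\<dots> \<le> e * norm (\<eta> - \<gamma>)"
      using e norm_bounded[of "\<eta> - \<gamma>" \<tau>] by simp
    finally show "norm ((superpose F \<eta> - superpose F \<gamma> - (\<Sum>i\<in>Basis. coeff_mult i (\<eta> - \<gamma>) (superpose (\<lambda>x. F' x i) \<gamma>))) \<tau>)
      \<le> e * norm (\<eta> - \<gamma>)" .
  qed
  then show "\<exists>d>0. \<forall>\<eta>. norm (\<eta> - \<gamma>) < d \<longrightarrow>
      norm (superpose F \<eta> - superpose F \<gamma> - (\<Sum>i\<in>Basis. coeff_mult i (\<eta> - \<gamma>) (superpose (\<lambda>x. F' x i) \<gamma>)))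
      \<le> e * norm (\<eta> - \<gamma>)"
    using d(1) by blast
qed

lemma Ck_on_superpose:
  fixes F :: "'a::euclidean_space \<Rightarrow> 'b::real_normed_vector"
    and y :: "'s::real_normed_vector \<Rightarrow> 't::topological_space \<Rightarrow>\<^sub>C 'a"
  assumes "open S" "Ck_on k S y" "Ck_on k UNIV F"
  shows "Ck_on k S (\<lambda>s. superpose F (y s))"
  using assms(2,3)
proof (induction k arbitrary: F)
  case 0
  then have "continuous_on UNIV (superpose F :: ('t \<Rightarrow>\<^sub>C 'a) \<Rightarrow> _)"
    using isCont_superpose[of F] by (intro continuous_at_imp_continuous_on) auto
  then show ?case
    using 0 by (auto intro: continuous_on_compose2)
next
  case (Suc k)
  let ?F' = "\<lambda>x. frechet_derivative F (at x)" and ?y' = "\<lambda>s. frechet_derivative y (at s)"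
  have F': "(F has_derivative ?F' x) (at x)" "continuous_on UNIV (\<lambda>x. ?F' x v)" for x v
    using Ck_on_has_derivative[OF Suc.prems(2)] Suc.prems(2)
      Ck_on_continuous_on[of k UNIV "\<lambda>x. ?F' x v"] by simp_all
  have der: "((\<lambda>s. superpose F (y s)) has_derivative
      (\<lambda>v. \<Sum>i\<in>Basis. coeff_mult i (?y' s v) (superpose (\<lambda>x. ?F' x i) (y s)))) (at s)" if "s \<in> S" for s
    by (rule has_derivative_compose[OF Ck_on_has_derivative[OF Suc.prems(1) that] superpose_has_derivative[OF F']])
  show ?case
  proof (rule Ck_on_SucI[OF assms(1) der])
    show "Ck_on k S (\<lambda>s. \<Sum>i\<in>Basis. coeff_mult i (?y' s v) (superpose (\<lambda>x. ?F' x i) (y s)))" for v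
      by (intro Ck_on_sum Ck_on_bilinear[OF bounded_bilinear_coeff_mult] assms(1) Suc.IH
          Ck_on_SucD[OF Suc.prems(1)]) (use Suc.prems in auto)
  qed auto
qed

text \<open>Clamping to the unit interval keeps the primitive bounded on the whole line.\<close>

definition primitive :: "(real \<Rightarrow>\<^sub>C 'a::euclidean_space) \<Rightarrow> real \<Rightarrow>\<^sub>C 'a"
  where "primitive \<gamma> = Bcontfun (\<lambda>\<tau>. integral {0..max 0 (min 1 \<tau>)} \<gamma>)"

lemma integrable_apply_bcontfun: "apply_bcontfun \<gamma> integrable_on {a..b}" for \<gamma> :: "real \<Rightarrow>\<^sub>C 'a::euclidean_space"
  by (rule integrable_continuous_real) simp

lemma norm_integral_apply_bcontfun:
  fixes \<gamma> :: "real \<Rightarrow>\<^sub>C 'a::euclidean_space"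
  shows "norm (integral {0..max 0 (min 1 \<tau>)} \<gamma>) \<le> norm \<gamma>"
proof -
  have "norm (integral {0..max 0 (min 1 \<tau>)} \<gamma>) \<le> norm \<gamma> * (max 0 (min 1 \<tau>) - 0)"
    by (rule integral_bound) (auto simp: norm_bounded)
  also have "\<dots> \<le> norm \<gamma> * 1"
    by (rule mult_left_mono) auto
  finally show ?thesis by simp
qed

lemma apply_primitive: "primitive \<gamma> \<tau> = integral {0..max 0 (min 1 \<tau>)} \<gamma>"
proof -
  have "continuous_on {0..1} (\<lambda>x. integral {0..x} \<gamma>)"
    by (rule indefinite_integral_continuous_1[OF integrable_apply_bcontfun])
  then have "continuous_on UNIV (\<lambda>\<tau>. integral {0..max 0 (min 1 \<tau>)} \<gamma>)"
    by (rule continuous_on_compose2) (auto intro!: continuous_intros)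
  then have "(\<lambda>\<tau>. integral {0..max 0 (min 1 \<tau>)} \<gamma>) \<in> bcontfun"
    using norm_integral_apply_bcontfun by (rule bcontfun_normI)
  then show ?thesis
    unfolding primitive_def by (subst Bcontfun_inverse) auto
qed

lemma bounded_linear_primitive: "bounded_linear primitive"
proof (rule bounded_linear_intro[where K=1])
  fix \<gamma> \<eta> :: "real \<Rightarrow>\<^sub>C 'a"
  show "primitive (\<gamma> + \<eta>) = primitive \<gamma> + primitive \<eta>"
    by (rule bcontfun_eqI)
      (simp add: apply_primitive integral_add[OF integrable_apply_bcontfun integrable_apply_bcontfun, symmetric]
        plus_bcontfun.rep_eq)
  show "norm (primitive \<gamma>) \<le> norm \<gamma> * 1"
    unfolding mult_1_right by (rule norm_bound) (simp add: apply_primitive norm_integral_apply_bcontfun)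
  show "primitive (r *\<^sub>R \<gamma>) = r *\<^sub>R primitive \<gamma>" for r
    by (rule bcontfun_eqI) (simp add: apply_primitive)
qed

lemma primitive_has_vector_derivative:
  assumes "\<tau> \<in> {0..1}"
  shows "(primitive \<gamma> has_vector_derivative \<gamma> \<tau>) (at \<tau> within {0..1})"
proof (rule has_vector_derivative_transform[OF assms])
  show "((\<lambda>x. integral {0..x} \<gamma>) has_vector_derivative \<gamma> \<tau>) (at \<tau> within {0..1})"
    using assms by (intro integral_has_vector_derivative) auto
qed (simp add: apply_primitive)

lemma primitive_0: "primitive \<gamma> 0 = 0"
  by (simp add: apply_primitive)

subsection \<open>Smooth dependence of flows on time and initial value\<close>

lemma blinfun_Neumann:
  fixes A :: "'a::banach \<Rightarrow>\<^sub>L 'a"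
  assumes "norm A < 1"
  obtains R where "R o\<^sub>L (id_blinfun - A) = id_blinfun" "(id_blinfun - A) o\<^sub>L R = id_blinfun"
proof -
  note bil = bounded_bilinear_blinfun_compose
  have "\<exists>!R. id_blinfun + (R o\<^sub>L A) = R"
  proof (rule banach_fix_type[of "norm A"])
    show "\<forall>x y. dist (id_blinfun + (x o\<^sub>L A)) (id_blinfun + (y o\<^sub>L A)) \<le> norm A * dist x y"
    proof (intro allI)
      show "dist (id_blinfun + (x o\<^sub>L A)) (id_blinfun + (y o\<^sub>L A)) \<le> norm A * dist x y" for x y
        using norm_blinfun_compose[of "x - y" A]
        by (simp add: dist_norm bounded_bilinear.diff_left[OF bil] mult.commute)
    qed
  qed (use assms in auto)
  then obtain R where R: "id_blinfun + (R o\<^sub>L A) = R" by blast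
  have "\<exists>!Q. id_blinfun + (A o\<^sub>L Q) = Q"
  proof (rule banach_fix_type[of "norm A"])
    show "\<forall>x y. dist (id_blinfun + (A o\<^sub>L x)) (id_blinfun + (A o\<^sub>L y)) \<le> norm A * dist x y"
    proof (intro allI)
      show "dist (id_blinfun + (A o\<^sub>L x)) (id_blinfun + (A o\<^sub>L y)) \<le> norm A * dist x y" for x y
        using norm_blinfun_compose[of A "x - y"]
        by (simp add: dist_norm bounded_bilinear.diff_right[OF bil])
    qed
  qed (use assms in auto)
  then obtain Q where Q: "id_blinfun + (A o\<^sub>L Q) = Q" by blast
  have 1: "R v - R (A v) = v" for v
    using arg_cong[OF R, of "\<lambda>f. blinfun_apply f v"] by (simp add: blinfun.add_left algebra_simps)
  have 2: "Q v - A (Q v) = v" for v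
    using arg_cong[OF Q, of "\<lambda>f. blinfun_apply f v"] by (simp add: blinfun.add_left algebra_simps)
  have "R v = Q v" for v
    using 1[of "Q v"] by (simp add: blinfun.diff_right[symmetric] 2)
  then have "R = Q" by (rule blinfun_eqI)
  show thesis
    by (rule that[of R]; rule blinfun_eqI)
      (use 1 2 in \<open>simp_all add: blinfun.diff_left blinfun.diff_right \<open>R = Q\<close>\<close>)
qed

text \<open>The equation \<open>\<gamma> = \<xi> + t N \<gamma>\<close>, solved by contraction for small \<open>t\<close>; with \<open>N\<close> the primitive
  of the superposition by a vector field it is the integral form of an initial value problem
  rescaled to the unit time interval, so that \<open>t\<close> becomes a parameter.\<close>

lemma fixed_point_family:
  fixes N :: "'x::banach \<Rightarrow> 'x" and N' :: "'x \<Rightarrow> 'x \<Rightarrow>\<^sub>L 'x"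
  assumes N': "\<And>\<gamma>. (N has_derivative N' \<gamma>) (at \<gamma>)" and cont: "isCont N' c"
  obtains \<epsilon> y where "\<epsilon> > 0"
    "\<And>t \<xi>. \<bar>t\<bar> < \<epsilon> \<Longrightarrow> \<xi> \<in> ball c \<epsilon> \<Longrightarrow> y (t, \<xi>) = \<xi> + t *\<^sub>R N (y (t, \<xi>))"
    "\<And>t \<xi>. \<bar>t\<bar> < \<epsilon> \<Longrightarrow> \<xi> \<in> ball c \<epsilon> \<Longrightarrow> norm (t *\<^sub>R N' (y (t, \<xi>))) < 1"
    "\<And>t \<xi> R. \<bar>t\<bar> < \<epsilon> \<Longrightarrow> \<xi> \<in> ball c \<epsilon> \<Longrightarrow> R o\<^sub>L (id_blinfun - t *\<^sub>R N' (y (t, \<xi>))) = id_blinfun \<Longrightarrow>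
       (y has_derivative (\<lambda>(\<tau>, \<eta>). R (\<eta> + \<tau> *\<^sub>R N (y (t, \<xi>))))) (at (t, \<xi>))"
proof -
  define L where "L = norm (N' c) + 1"
  have L: "L > 0" by (simp add: L_def add_nonneg_pos)
  obtain \<delta>0 where \<delta>0: "\<delta>0 > 0" "\<And>\<gamma>. dist \<gamma> c < \<delta>0 \<Longrightarrow> dist (N' \<gamma>) (N' c) < 1"
    using cont unfolding continuous_at_eps_delta by (meson zero_less_one)
  define \<delta> where "\<delta> = min (\<delta>0 / 2) 1"
  have \<delta>: "\<delta> > 0" "\<delta> \<le> 1" "\<delta> < \<delta>0" using \<delta>0(1) by (auto simp: \<delta>_def min_def)
  have boundN': "norm (N' \<gamma>) \<le> L" if "\<gamma> \<in> cball c \<delta>" for \<gamma>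
  proof -
    have "norm (N' \<gamma> - N' c) < 1"
      using that \<delta> \<delta>0(2)[of \<gamma>] by (simp add: dist_commute dist_norm)
    then show ?thesis
      using norm_triangle_sub[of "N' \<gamma>" "N' c"] by (simp add: L_def)
  qed
  have lip: "norm (N \<gamma> - N \<eta>) \<le> L * norm (\<gamma> - \<eta>)" if "\<gamma> \<in> cball c \<delta>" "\<eta> \<in> cball c \<delta>" for \<gamma> \<eta>
    using that boundN' has_derivative_at_withinI[OF N']
    by (intro differentiable_bound[OF convex_cball, where f'="\<lambda>\<gamma>. N' \<gamma>"]) (auto simp: norm_blinfun.rep_eq[symmetric])
  define K where "K = norm (N c) + L"
  have K: "K > 0" using L by (simp add: K_def add_nonneg_pos)
  have boundN: "norm (N \<gamma>) \<le> K" if "\<gamma> \<in> cball c \<delta>" for \<gamma>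
  proof -
    have "norm (N \<gamma> - N c) \<le> L * norm (\<gamma> - c)"
      using that \<delta> by (intro lip) auto
    also have "\<dots> \<le> L * 1"
      using that \<delta> L by (intro mult_left_mono) (auto simp: dist_norm norm_minus_commute)
    finally show ?thesis
      using norm_triangle_sub[of "N \<gamma>" "N c"] by (simp add: K_def)
  qed
  define \<epsilon> where "\<epsilon> = min (\<delta> / 2) (min (1 / (2 * L)) (\<delta> / (2 * K)))"
  have \<epsilon>: "\<epsilon> > 0" "\<epsilon> \<le> \<delta> / 2"
    using \<delta> L K by (auto simp: \<epsilon>_def)
  have tL: "\<bar>t\<bar> * L \<le> 1 / 2" and tK: "\<bar>t\<bar> * K \<le> \<delta> / 2" if "\<bar>t\<bar> < \<epsilon>" for t
  proof -
    have "\<bar>t\<bar> \<le> 1 / (2 * L)" "\<bar>t\<bar> \<le> \<delta> / (2 * K)"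
      using that by (auto simp: \<epsilon>_def)
    then show "\<bar>t\<bar> * L \<le> 1 / 2" "\<bar>t\<bar> * K \<le> \<delta> / 2"
      using L K by (auto simp: field_simps)
  qed
  define T where "T = {-\<epsilon><..<\<epsilon>} \<times> ball c \<epsilon>"
  have T: "open T" "\<And>t \<xi>. (t, \<xi>) \<in> T \<longleftrightarrow> \<bar>t\<bar> < \<epsilon> \<and> \<xi> \<in> ball c \<epsilon>"
    by (auto simp: T_def open_Times)
  have contraction: "norm (t *\<^sub>R N \<gamma> - t *\<^sub>R N \<eta>) \<le> 1 / 2 * norm (\<gamma> - \<eta>)"
    if "\<bar>t\<bar> < \<epsilon>" "\<gamma> \<in> cball c \<delta>" "\<eta> \<in> cball c \<delta>" for t \<gamma> \<eta>
  proof -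
    have "norm (t *\<^sub>R N \<gamma> - t *\<^sub>R N \<eta>) = \<bar>t\<bar> * norm (N \<gamma> - N \<eta>)"
      by (simp add: scaleR_diff_right[symmetric])
    also have "\<dots> \<le> \<bar>t\<bar> * (L * norm (\<gamma> - \<eta>))"
      using lip[OF that(2,3)] by (intro mult_left_mono) auto
    also have "\<dots> = (\<bar>t\<bar> * L) * norm (\<gamma> - \<eta>)" by simp
    also have "\<dots> \<le> 1 / 2 * norm (\<gamma> - \<eta>)"
      using tL[OF that(1)] by (intro mult_right_mono) auto
    finally show ?thesis .
  qed
  have "\<exists>\<gamma>\<in>cball c \<delta>. \<gamma> = snd z + fst z *\<^sub>R N \<gamma>" if "z \<in> T" for z
  proof -
    obtain t \<xi> where z: "z = (t, \<xi>)" by (cases z)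
    have z': "\<bar>t\<bar> < \<epsilon>" "dist c \<xi> < \<epsilon>" using that by (auto simp: z T(2))
    have "\<exists>!\<gamma>\<in>cball c \<delta>. \<xi> + t *\<^sub>R N \<gamma> = \<gamma>"
    proof (rule Banach_fix[of _ "1 / 2"])
      show "(\<lambda>\<gamma>. \<xi> + t *\<^sub>R N \<gamma>) ` cball c \<delta> \<subseteq> cball c \<delta>"
      proof safe
        fix \<gamma> assume \<gamma>: "\<gamma> \<in> cball c \<delta>"
        have "norm (t *\<^sub>R N \<gamma>) \<le> \<bar>t\<bar> * K"
          using boundN[OF \<gamma>] by (auto intro: mult_left_mono)
        moreover have "norm (c - \<xi>) \<le> \<delta> / 2"
          using z' \<epsilon> by (simp add: dist_norm)
        ultimately have "norm ((c - \<xi>) - t *\<^sub>R N \<gamma>) \<le> \<delta>"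
          using tK[OF z'(1)] norm_triangle_ineq4[of "c - \<xi>" "t *\<^sub>R N \<gamma>"] by linarith
        then show "\<xi> + t *\<^sub>R N \<gamma> \<in> cball c \<delta>"
          by (simp add: dist_norm algebra_simps)
      qed
      show "dist (\<xi> + t *\<^sub>R N \<gamma>) (\<xi> + t *\<^sub>R N \<eta>) \<le> 1 / 2 * dist \<gamma> \<eta>"
        if "\<gamma> \<in> cball c \<delta>" "\<eta> \<in> cball c \<delta>" for \<gamma> \<eta>
        using contraction[OF z'(1) that] by (simp add: dist_norm)
      show "complete (cball c \<delta>)" "cball c \<delta> \<noteq> {}"
        using \<delta> by (auto simp: complete_eq_closed)
    qed auto
    then show ?thesis unfolding z fst_conv snd_conv by metis
  qed
  then obtain y where y: "\<And>z. z \<in> T \<Longrightarrow> y z \<in> cball c \<delta>" "\<And>z. z \<in> T \<Longrightarrow> y z = snd z + fst z *\<^sub>R N (y z)"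
    by metis
  have bound: "norm (y w - y z) \<le> 2 * (norm (snd w - snd z) + \<bar>fst w - fst z\<bar> * K)" if "w \<in> T" "z \<in> T" for w z
  proof -
    have w: "\<bar>fst w\<bar> < \<epsilon>" using that(1) T(2)[of "fst w" "snd w"] by simp
    have "y w - y z = ((snd w + fst w *\<^sub>R N (y w)) - (snd z + fst z *\<^sub>R N (y z)))"
      by (rule arg_cong2[OF y(2)[OF that(1)] y(2)[OF that(2)]])
    also have "\<dots> = (snd w - snd z) + (fst w - fst z) *\<^sub>R N (y z) + (fst w *\<^sub>R N (y w) - fst w *\<^sub>R N (y z))"
      by (simp add: algebra_simps)
    also have "norm \<dots> \<le> (norm (snd w - snd z) + norm ((fst w - fst z) *\<^sub>R N (y z))) + norm (fst w *\<^sub>R N (y w) - fst w *\<^sub>R N (y z))"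
      by (intro norm_triangle_mono norm_triangle_ineq order_refl)
    finally have "norm (y w - y z) \<le> norm (snd w - snd z) + \<bar>fst w - fst z\<bar> * norm (N (y z)) + norm (fst w *\<^sub>R N (y w) - fst w *\<^sub>R N (y z))"
      by simp
    moreover have "\<bar>fst w - fst z\<bar> * norm (N (y z)) \<le> \<bar>fst w - fst z\<bar> * K"
      using boundN[OF y(1)[OF that(2)]] by (intro mult_left_mono) auto
    moreover note contraction[OF w y(1)[OF that(1)] y(1)[OF that(2)]]
    moreover have "a \<le> s + p + q \<Longrightarrow> p \<le> r \<Longrightarrow> q \<le> 1 / 2 * a \<Longrightarrow> a \<le> 2 * (s + r)" for a s p q r :: real
      by simp
    ultimately show ?thesis by blast
  qed
  have cont: "isCont y z" if "z \<in> T" for z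
  proof -
    have lim: "((\<lambda>w. 2 * (norm (snd w - snd z) + \<bar>fst w - fst z\<bar> * K)) \<longlongrightarrow> 2 * (norm (snd z - snd z) + \<bar>fst z - fst z\<bar> * K)) (at z)"
      by (intro tendsto_intros)
    have "((\<lambda>w. y w - y z) \<longlongrightarrow> 0) (at z)"
    proof (rule Lim_null_comparison)
      show "\<forall>\<^sub>F w in at z. norm (y w - y z) \<le> 2 * (norm (snd w - snd z) + \<bar>fst w - fst z\<bar> * K)"
        using eventually_at_in_open'[OF T(1) that] by eventually_elim (use bound that in blast)
    qed (use lim in simp)
    then show ?thesis unfolding isCont_def by (rule LIM_zero_cancel)
  qed
  show thesis
  proof (rule that[OF \<epsilon>(1)])
    fix t \<xi> assume z: "\<bar>t\<bar> < \<epsilon>" "\<xi> \<in> ball c \<epsilon>"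
    then have zT: "(t, \<xi>) \<in> T" by (simp add: T(2))
    show eq: "y (t, \<xi>) = \<xi> + t *\<^sub>R N (y (t, \<xi>))"
      using y(2)[OF zT] unfolding fst_conv snd_conv .
    have "norm (t *\<^sub>R N' (y (t, \<xi>))) \<le> \<bar>t\<bar> * L"
      using boundN'[OF y(1)[OF zT]] by (auto intro: mult_left_mono)
    then show "norm (t *\<^sub>R N' (y (t, \<xi>))) < 1"
      using tL[OF z(1)] by simp
    fix R :: "'x \<Rightarrow>\<^sub>L 'x" assume "R o\<^sub>L (id_blinfun - t *\<^sub>R N' (y (t, \<xi>))) = id_blinfun"
    then have "blinfun_apply (R o\<^sub>L (id_blinfun - t *\<^sub>R N' (y (t, \<xi>)))) \<eta> = \<eta>" for \<eta>
      by simp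
    then have R: "R (\<eta> - t *\<^sub>R N' (y (t, \<xi>)) \<eta>) = \<eta>" for \<eta>
      by (simp add: blinfun.diff_left blinfun.scaleR_left)
    let ?\<gamma> = "y (t, \<xi>)"
    let ?H = "\<lambda>w. (fst w, snd w - fst w *\<^sub>R N (snd w))"
    let ?g = "\<lambda>w. (fst w, y w)"
    let ?g' = "\<lambda>w. (fst w, R (snd w + fst w *\<^sub>R N ?\<gamma>))"
    have "(?g has_derivative ?g') (at (t, \<xi>))"
    proof (rule has_derivative_inverse_basic)
      have "((\<lambda>w. N (snd w)) has_derivative (\<lambda>w. N' ?\<gamma> (snd w))) (at (t, ?\<gamma>))"
        by (rule has_derivative_compose[OF has_derivative_snd[OF has_derivative_ident], of N]) (simp add: N')
      then show "(?H has_derivative (\<lambda>w. (fst w, snd w - (t *\<^sub>R N' ?\<gamma> (snd w) + fst w *\<^sub>R N ?\<gamma>)))) (at (?g (t, \<xi>)))"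
        by (auto intro!: derivative_eq_intros)
      show "bounded_linear ?g'"
        by (intro bounded_linear_Pair bounded_linear_fst bounded_linear_compose[OF blinfun.bounded_linear_right]
            bounded_linear_add bounded_linear_snd bounded_linear_scaleR_const)
      show "?g' \<circ> (\<lambda>w. (fst w, snd w - (t *\<^sub>R N' ?\<gamma> (snd w) + fst w *\<^sub>R N ?\<gamma>))) = id"
        using R by (auto simp: fun_eq_iff)
      show "continuous (at (t, \<xi>)) ?g"
        by (intro continuous_Pair continuous_fst continuous_ident cont[OF zT])
      show "?H (?g w) = w" if "w \<in> T" for w
        using diff_eq_eq[THEN iffD2, OF y(2)[OF that]] by (simp add: prod_eq_iff)
    qed (use T(1) zT in auto)
    from has_derivative_snd[OF this]
    show "(y has_derivative (\<lambda>(\<tau>, \<eta>). R (\<eta> + \<tau> *\<^sub>R N ?\<gamma>))) (at (t, \<xi>))"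
      by (simp add: case_prod_unfold)
  qed
qed

lemma bounded_linear_const_bcontfun:
  "bounded_linear (const_bcontfun :: 'a::real_normed_vector \<Rightarrow> 't::topological_space \<Rightarrow>\<^sub>C 'a)"
  by (rule bounded_linear_intro[where K=1])
    (auto intro!: bcontfun_eqI norm_bound simp: const_bcontfun.rep_eq)

lemma bounded_linear_apply_bcontfun:
  "bounded_linear (\<lambda>\<gamma> :: 't::topological_space \<Rightarrow>\<^sub>C 'a::real_normed_vector. \<gamma> \<tau>)"
  by (rule bounded_linear_intro[where K=1]) (auto intro: norm_bounded)

lemma local_flow:
  fixes F :: "'a::euclidean_space \<Rightarrow> 'a"
  assumes "smooth_on UNIV F"
  obtains \<epsilon> Y where "\<epsilon> > 0"
    "\<And>\<tau>. smooth_on ({-\<epsilon><..<\<epsilon>} \<times> ball c \<epsilon>) (Y \<tau>)"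
    "\<And>t s. (t, s) \<in> {-\<epsilon><..<\<epsilon>} \<times> ball c \<epsilon> \<Longrightarrow> Y 0 (t, s) = s"
    "\<And>t s \<tau>. (t, s) \<in> {-\<epsilon><..<\<epsilon>} \<times> ball c \<epsilon> \<Longrightarrow> \<tau> \<in> {0..1} \<Longrightarrow>
       ((\<lambda>\<tau>. Y \<tau> (t, s)) has_vector_derivative t *\<^sub>R F (Y \<tau> (t, s))) (at \<tau> within {0..1})"
    "\<And>t s a v \<tau>. (t, s) \<in> {-\<epsilon><..<\<epsilon>} \<times> ball c \<epsilon> \<Longrightarrow> \<tau> \<in> {0..1} \<Longrightarrow>
       ((\<lambda>\<tau>. frechet_derivative (Y \<tau>) (at (t, s)) (a, v)) has_vector_derivative
         a *\<^sub>R F (Y \<tau> (t, s)) + t *\<^sub>R frechet_derivative F (at (Y \<tau> (t, s)))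
           (frechet_derivative (Y \<tau>) (at (t, s)) (a, v))) (at \<tau> within {0..1})"
proof -
  let ?F' = "\<lambda>x. frechet_derivative F (at x)"
  have F': "(F has_derivative ?F' x) (at x)" for x
    using smooth_on_has_derivative[OF assms] by simp
  have contF: "continuous_on UNIV F" and contF': "continuous_on UNIV (\<lambda>x. ?F' x v)" for v
    using Ck_on_continuous_on[OF smooth_onD[where k=0]] assms smooth_on_partial by blast+
  define N :: "(real \<Rightarrow>\<^sub>C 'a) \<Rightarrow> real \<Rightarrow>\<^sub>C 'a" where "N \<gamma> = primitive (superpose F \<gamma>)" for \<gamma>
  define P :: "(real \<Rightarrow>\<^sub>C 'a) \<Rightarrow>\<^sub>L (real \<Rightarrow>\<^sub>C 'a)" where "P = Blinfun primitive"
  have P: "blinfun_apply P = primitive"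
    unfolding P_def by (rule bounded_linear_Blinfun_apply[OF bounded_linear_primitive])
  define M :: "'a \<Rightarrow> (real \<Rightarrow>\<^sub>C 'a) \<Rightarrow> (real \<Rightarrow>\<^sub>C 'a) \<Rightarrow>\<^sub>L (real \<Rightarrow>\<^sub>C 'a)"
    where "M i = bounded_bilinear.prod_left (coeff_mult i)" for i
  have M: "blinfun_apply (M i g) \<eta> = coeff_mult i \<eta> g" and linM: "bounded_linear (M i)" for i g \<eta>
    unfolding M_def
    by (simp_all add: bounded_bilinear.prod_left.rep_eq[OF bounded_bilinear_coeff_mult]
        bounded_bilinear.bounded_linear_prod_left[OF bounded_bilinear_coeff_mult])
  define N' where "N' \<gamma> = P o\<^sub>L (\<Sum>i\<in>Basis. M i (superpose (\<lambda>x. ?F' x i) \<gamma>))" for \<gamma>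
  have N'_apply: "N' \<gamma> \<eta> = primitive (\<Sum>i\<in>Basis. coeff_mult i \<eta> (superpose (\<lambda>x. ?F' x i) \<gamma>))" for \<gamma> \<eta>
    by (simp add: N'_def P M blinfun.sum_left)
  have pointwise: "(\<Sum>i\<in>Basis. coeff_mult i \<eta> (superpose (\<lambda>x. ?F' x i) \<gamma>)) \<tau> = ?F' (\<gamma> \<tau>) (\<eta> \<tau>)"
    for \<gamma> \<eta> :: "real \<Rightarrow>\<^sub>C 'a" and \<tau>
    by (subst linear_eq_sum_Basis[OF has_derivative_linear[OF F']])
      (simp add: apply_bcontfun_sum apply_coeff_mult apply_superpose contF')
  have derN: "(N has_derivative N' \<gamma>) (at \<gamma>)" for \<gamma>
    using bounded_linear.has_derivative[OF bounded_linear_primitive superpose_has_derivative[OF F' contF', of \<gamma>]]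
    by (simp add: N_def[abs_def] N'_apply[abs_def])
  have smoothN': "Ck_on k S (\<lambda>z. N' (y z))" if "open S" "Ck_on k S y"
    for k and S :: "(real \<times> 'a) set" and y
    unfolding N'_def
    by (intro Ck_on_linear_compose[OF bounded_bilinear.bounded_linear_right[OF bounded_bilinear_blinfun_compose]]
        Ck_on_sum Ck_on_linear_compose[OF linM] Ck_on_superpose that smooth_onD smooth_on_partial assms)
  have contN': "isCont N' \<gamma>" for \<gamma>
    unfolding N'_def
    by (intro bounded_linear.isCont[OF bounded_bilinear.bounded_linear_right[OF bounded_bilinear_blinfun_compose]]
        continuous_sum bounded_linear.isCont[OF linM] isCont_superpose contF')
  obtain \<epsilon> y where "\<epsilon> > 0"
    and y_eq: "\<And>t \<xi>. \<bar>t\<bar> < \<epsilon> \<Longrightarrow> \<xi> \<in> ball (const_bcontfun c) \<epsilon> \<Longrightarrow> y (t, \<xi>) = \<xi> + t *\<^sub>R N (y (t, \<xi>))"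
    and small: "\<And>t \<xi>. \<bar>t\<bar> < \<epsilon> \<Longrightarrow> \<xi> \<in> ball (const_bcontfun c) \<epsilon> \<Longrightarrow> norm (t *\<^sub>R N' (y (t, \<xi>))) < 1"
    and der: "\<And>t \<xi> R. \<bar>t\<bar> < \<epsilon> \<Longrightarrow> \<xi> \<in> ball (const_bcontfun c) \<epsilon> \<Longrightarrow>
       R o\<^sub>L (id_blinfun - t *\<^sub>R N' (y (t, \<xi>))) = id_blinfun \<Longrightarrow>
       (y has_derivative (\<lambda>(\<tau>, \<eta>). R (\<eta> + \<tau> *\<^sub>R N (y (t, \<xi>))))) (at (t, \<xi>))"
    using fixed_point_family[of N N' "const_bcontfun c"] derN contN' by metis
  define T where "T = {-\<epsilon><..<\<epsilon>} \<times> ball c \<epsilon>"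
  define u :: "real \<times> 'a \<Rightarrow> real \<Rightarrow>\<^sub>C 'a" where "u z = y (fst z, const_bcontfun (snd z))" for z
  have T: "open T" by (simp add: T_def open_Times)
  have ball: "\<bar>fst z\<bar> < \<epsilon>" "const_bcontfun (snd z) \<in> ball (const_bcontfun c :: real \<Rightarrow>\<^sub>C 'a) \<epsilon>" if "z \<in> T" for z
  proof -
    have "dist (const_bcontfun c :: real \<Rightarrow>\<^sub>C 'a) (const_bcontfun (snd z)) \<le> dist c (snd z)"
      by (rule dist_bound) (simp add: const_bcontfun.rep_eq)
    then show "\<bar>fst z\<bar> < \<epsilon>" "const_bcontfun (snd z) \<in> ball (const_bcontfun c :: real \<Rightarrow>\<^sub>C 'a) \<epsilon>"
      using that by (auto simp: T_def)
  qed
  have u_eq: "u z = const_bcontfun (snd z) + fst z *\<^sub>R N (u z)" if "z \<in> T" for z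
    unfolding u_def by (rule y_eq[OF ball[OF that]])
  have "\<exists>R. z \<in> T \<longrightarrow> R o\<^sub>L (id_blinfun - fst z *\<^sub>R N' (u z)) = id_blinfun \<and>
      (id_blinfun - fst z *\<^sub>R N' (u z)) o\<^sub>L R = id_blinfun" for z
    using blinfun_Neumann[OF small[OF ball], of z] unfolding u_def by metis
  then obtain R where R: "\<And>z. z \<in> T \<Longrightarrow> R z o\<^sub>L (id_blinfun - fst z *\<^sub>R N' (u z)) = id_blinfun"
    "\<And>z. z \<in> T \<Longrightarrow> (id_blinfun - fst z *\<^sub>R N' (u z)) o\<^sub>L R z = id_blinfun"
    by metis
  let ?u' = "\<lambda>z w. R z (const_bcontfun (snd w) + fst w *\<^sub>R N (u z))"
  have u': "(u has_derivative ?u' z) (at z)" if "z \<in> T" for z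
  proof -
    have "((\<lambda>z. (fst z, const_bcontfun (snd z))) has_derivative (\<lambda>w. (fst w, const_bcontfun (snd w)))) (at z)"
      by (intro has_derivative_Pair has_derivative_fst has_derivative_ident
          bounded_linear.has_derivative[OF bounded_linear_const_bcontfun] has_derivative_snd)
    from has_derivative_compose[OF this der[OF ball[OF that]]] R(1)[OF that]
    show ?thesis by (simp add: u_def[abs_def])
  qed
  have u'_eq: "?u' z w = const_bcontfun (snd w) + fst w *\<^sub>R N (u z) + fst z *\<^sub>R N' (u z) (?u' z w)" if "z \<in> T" for z w
  proof -
    have "blinfun_apply ((id_blinfun - fst z *\<^sub>R N' (u z)) o\<^sub>L R z) (const_bcontfun (snd w) + fst w *\<^sub>R N (u z))
        = const_bcontfun (snd w) + fst w *\<^sub>R N (u z)"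
      using R(2)[OF that] by simp
    then show ?thesis
      by (simp add: blinfun.diff_left blinfun.scaleR_left diff_eq_eq)
  qed
  have smooth_u: "Ck_on k T u" for k
  proof (induction k)
    case 0
    then show ?case
      using has_derivative_continuous[OF u'] T by (simp add: continuous_on_eq_continuous_at)
  next
    case (Suc k)
    have fst: "Ck_on k T fst" and snd: "Ck_on k T snd"
      by (simp_all add: Ck_on_linear T bounded_linear_fst bounded_linear_snd)
    have "Ck_on k T (\<lambda>z. id_blinfun - fst z *\<^sub>R N' (u z))"
      by (intro Ck_on_diff Ck_on_const Ck_on_bilinear[OF bounded_bilinear_scaleR] fst smoothN' T Suc)
    then have "Ck_on k T R"
      by (rule Ck_on_blinfun_inverse[OF T _ R])
    moreover have "Ck_on k T (\<lambda>z. N (u z))"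
      unfolding N_def
      by (intro Ck_on_linear_compose[OF bounded_linear_primitive] Ck_on_superpose T Suc smooth_onD assms)
    ultimately have *: "Ck_on k T (\<lambda>z. ?u' z w)" for w
      by (intro Ck_on_bilinear[OF bounded_bilinear_blinfun_apply] Ck_on_add Ck_on_const T
          Ck_on_linear_compose[OF bounded_linear_scaleR_right])
    show ?case
      by (rule Ck_on_SucI[OF T u' *])
  qed
  define Y where "Y \<tau> z = u z \<tau>" for \<tau> z
  have Y': "(Y \<tau> has_derivative (\<lambda>w. ?u' z w \<tau>)) (at z)" if "z \<in> T" for \<tau> z
    using bounded_linear.has_derivative[OF bounded_linear_apply_bcontfun u'[OF that]] by (simp add: Y_def[abs_def])
  have frechet_Y: "frechet_derivative (Y \<tau>) (at z) w = ?u' z w \<tau>" if "z \<in> T" for \<tau> z w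
    by (simp add: frechet_derivative_at[OF Y'[OF that], symmetric])
  have der_N: "((\<lambda>\<tau>. N \<gamma> \<tau>) has_vector_derivative F (\<gamma> \<tau>)) (at \<tau> within {0..1})" if "\<tau> \<in> {0..1}" for \<gamma> \<tau>
    using primitive_has_vector_derivative[OF that, of "superpose F \<gamma>"]
    by (simp add: N_def apply_superpose contF)
  have der_N': "((\<lambda>\<tau>. N' \<gamma> \<eta> \<tau>) has_vector_derivative ?F' (\<gamma> \<tau>) (\<eta> \<tau>)) (at \<tau> within {0..1})" if "\<tau> \<in> {0..1}" for \<gamma> \<eta> \<tau>
    using primitive_has_vector_derivative[OF that, of "\<Sum>i\<in>Basis. coeff_mult i \<eta> (superpose (\<lambda>x. ?F' x i) \<gamma>)"]
    by (simp only: N'_apply pointwise)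
  show thesis
  proof (rule that[of \<epsilon> Y, folded T_def])
    show "smooth_on T (Y \<tau>)" for \<tau>
      unfolding smooth_on_def Y_def
      by (intro allI Ck_on_linear_compose[OF bounded_linear_apply_bcontfun] T smooth_u)
    show "Y 0 (t, s) = s" if "(t, s) \<in> T" for t s
      unfolding Y_def by (subst u_eq[OF that]) (simp add: N_def primitive_0 const_bcontfun.rep_eq)
    show "((\<lambda>\<tau>. Y \<tau> (t, s)) has_vector_derivative t *\<^sub>R F (Y \<tau> (t, s))) (at \<tau> within {0..1})"
      if "(t, s) \<in> T" "\<tau> \<in> {0..1}" for t s \<tau>
    proof -
      have eq: "Y \<tau> (t, s) = s + t *\<^sub>R N (u (t, s)) \<tau>" for \<tau>
        unfolding Y_def by (subst u_eq[OF that(1)]) (simp add: const_bcontfun.rep_eq)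
      have "((\<lambda>\<tau>. s + t *\<^sub>R N (u (t, s)) \<tau>) has_vector_derivative 0 + t *\<^sub>R F (u (t, s) \<tau>)) (at \<tau> within {0..1})"
        by (intro has_vector_derivative_add has_vector_derivative_const
            bounded_linear.has_vector_derivative[OF bounded_linear_scaleR_right] der_N that)
      then show ?thesis
        by (subst eq) (simp add: Y_def)
    qed
    show "((\<lambda>\<tau>. frechet_derivative (Y \<tau>) (at (t, s)) (a, v)) has_vector_derivative
         a *\<^sub>R F (Y \<tau> (t, s)) + t *\<^sub>R ?F' (Y \<tau> (t, s)) (frechet_derivative (Y \<tau>) (at (t, s)) (a, v))) (at \<tau> within {0..1})"
      if "(t, s) \<in> T" "\<tau> \<in> {0..1}" for t s a v \<tau>
    proof -
      define \<eta> where "\<eta> = ?u' (t, s) (a, v)"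
      have eq: "\<eta> \<tau> = v + a *\<^sub>R N (u (t, s)) \<tau> + t *\<^sub>R N' (u (t, s)) \<eta> \<tau>" for \<tau>
        using arg_cong[OF u'_eq[OF that(1), of "(a, v)"], of "\<lambda>g. apply_bcontfun g \<tau>"]
        unfolding \<eta>_def[symmetric] by (simp add: const_bcontfun.rep_eq)
      have "((\<lambda>\<tau>. v + a *\<^sub>R N (u (t, s)) \<tau> + t *\<^sub>R N' (u (t, s)) \<eta> \<tau>) has_vector_derivative
          0 + a *\<^sub>R F (u (t, s) \<tau>) + t *\<^sub>R ?F' (u (t, s) \<tau>) (\<eta> \<tau>)) (at \<tau> within {0..1})"
        by (intro has_vector_derivative_add has_vector_derivative_const
            bounded_linear.has_vector_derivative[OF bounded_linear_scaleR_right] der_N der_N' that)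
      then have "((\<lambda>\<tau>. \<eta> \<tau>) has_vector_derivative a *\<^sub>R F (u (t, s) \<tau>) + t *\<^sub>R ?F' (u (t, s) \<tau>) (\<eta> \<tau>)) (at \<tau> within {0..1})"
        unfolding eq[symmetric] by simp
      then show ?thesis
        by (simp add: frechet_Y[OF that(1)] \<eta>_def Y_def)
    qed
  qed fact
qed

subsection \<open>Hamiltonian flows\<close>

definition sympl :: "'n::finite phase_space \<Rightarrow> 'n phase_space \<Rightarrow> real"
  where "sympl u v = fst u \<bullet> snd v - snd u \<bullet> fst v"

definition e_y :: "'n::finite \<Rightarrow> 'n phase_space"
  where "e_y i = (0, axis i 1)"

definition rotate_xy :: "'n::finite phase_space \<Rightarrow> 'n phase_space"
  where "rotate_xy u = (snd u, - fst u)"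

lemma bounded_linear_coord_x: "bounded_linear (coord_x i)"
  unfolding coord_x_def[abs_def] by (intro bounded_linear_compose[OF bounded_linear_vec_nth] bounded_linear_fst)

lemma bounded_linear_coord_y: "bounded_linear (coord_y i)"
  unfolding coord_y_def[abs_def] by (intro bounded_linear_compose[OF bounded_linear_vec_nth] bounded_linear_snd)

lemma frechet_derivative_bounded_linear: "bounded_linear f \<Longrightarrow> frechet_derivative f (at x) = f"
  using frechet_derivative_at[OF bounded_linear_imp_has_derivative] by metis

lemma omega0_eq_sympl: "omega0 z u v = sympl u v"
  by (simp add: omega0_def wedge_def differential_def sympl_def inner_vec_def sum_subtractf mult.commute
      frechet_derivative_bounded_linear bounded_linear_coord_x bounded_linear_coord_y coord_x_def coord_y_def)

lemma bounded_bilinear_sympl: "bounded_bilinear (sympl :: 'n::finite phase_space \<Rightarrow> _)"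
proof
  have "\<bar>sympl u v\<bar> \<le> norm u * norm v * 2" for u v :: "'n phase_space"
  proof -
    have n: "norm (fst u) \<le> norm u" "norm (snd u) \<le> norm u" for u :: "'n phase_space"
      by (metis norm_fst_le prod.collapse) (metis norm_snd_le prod.collapse)
    have "\<bar>fst u \<bullet> snd v\<bar> \<le> norm u * norm v"
      by (intro order_trans[OF Cauchy_Schwarz_ineq2] mult_mono n) auto
    moreover have "\<bar>snd u \<bullet> fst v\<bar> \<le> norm u * norm v"
      by (intro order_trans[OF Cauchy_Schwarz_ineq2] mult_mono n) auto
    ultimately show ?thesis unfolding sympl_def by linarith
  qed
  then show "\<exists>K. \<forall>u v :: 'n phase_space. norm (sympl u v) \<le> norm u * norm v * K"
    by auto
qed (auto simp: sympl_def algebra_simps inner_simps)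

interpretation sympl: bounded_bilinear sympl
  by (rule bounded_bilinear_sympl)

lemma sympl_flip: "sympl u v = - sympl v u"
  by (simp add: sympl_def inner_commute)

lemma sympl_rotate_xy: "sympl (rotate_xy u) v = u \<bullet> v"
  by (simp add: sympl_def rotate_xy_def inner_prod_def)

lemma sympl_nondegenerate: "(\<And>v. sympl u v = 0) \<Longrightarrow> u = 0"
  using sympl_flip[of u "rotate_xy u"] by (simp add: sympl_rotate_xy)

definition hamiltonian_field :: "('n::finite phase_space \<Rightarrow> real) \<Rightarrow> 'n phase_space \<Rightarrow> 'n phase_space"
  where "hamiltonian_field p w = (\<Sum>b\<in>Basis. frechet_derivative p (at w) b *\<^sub>R rotate_xy b)"

lemma smooth_hamiltonian_field: "smooth_on UNIV p \<Longrightarrow> smooth_on UNIV (hamiltonian_field p)"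
  unfolding smooth_on_def hamiltonian_field_def
  by (intro allI Ck_on_sum Ck_on_linear_compose[OF bounded_linear_scaleR_left] open_UNIV
      smooth_onD smooth_on_partial) (simp add: smooth_on_def)

lemma sympl_hamiltonian_field:
  assumes "smooth_on UNIV p"
  shows "sympl (hamiltonian_field p w) v = frechet_derivative p (at w) v"
proof -
  have "linear (frechet_derivative p (at w))"
    using smooth_on_has_derivative[OF assms, of w] by (simp add: has_derivative_linear)
  from linear_eq_sum_Basis[OF this, of v] show ?thesis
    by (simp add: hamiltonian_field_def sympl.sum_left sympl.scaleR_left sympl_rotate_xy inner_commute mult.commute)
qed

lemma sympl_derivative_hamiltonian_field:
  assumes "smooth_on UNIV p"
  shows "sympl (frechet_derivative (hamiltonian_field p) (at w) u) v
       = frechet_derivative (\<lambda>x. frechet_derivative p (at x) v) (at w) u"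
proof -
  have "(hamiltonian_field p has_derivative frechet_derivative (hamiltonian_field p) (at w)) (at w)"
    using smooth_on_has_derivative[OF smooth_hamiltonian_field[OF assms]] by simp
  from fun_cong[OF frechet_derivative_at[OF bounded_linear.has_derivative[OF sympl.bounded_linear_left this, of v]], of u]
  show ?thesis
    by (simp add: sympl_hamiltonian_field[OF assms])
qed

lemma zero_vector_derivative_01_eq:
  fixes g :: "real \<Rightarrow> 'a::real_normed_vector"
  assumes "\<And>\<tau>. \<tau> \<in> {0..1} \<Longrightarrow> (g has_vector_derivative 0) (at \<tau> within {0..1})" "\<tau> \<in> {0..1}"
  shows "g \<tau> = g 0"
proof -
  obtain k where "\<And>\<tau>. \<tau> \<in> {0..1} \<Longrightarrow> g \<tau> = k"
    using has_derivative_zero_constant[of "{0..1}" g] assms(1) by (auto simp: has_vector_derivative_def)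
  then show ?thesis using assms(2) by simp
qed

lemma hamiltonian_flow:
  fixes p :: "'n::finite phase_space \<Rightarrow> real"
  assumes "smooth_on UNIV p"
  obtains T \<Psi> where "open T" "(0, z) \<in> T" "smooth_on T \<Psi>" "\<Psi> (0, z) = z"
    "\<And>t s. (t, s) \<in> T \<Longrightarrow> p (\<Psi> (t, s)) = p s"
    "\<And>t s a v b w. (t, s) \<in> T \<Longrightarrow>
       sympl (frechet_derivative \<Psi> (at (t, s)) (a, v)) (frechet_derivative \<Psi> (at (t, s)) (b, w))
       = sympl v w + a * frechet_derivative p (at s) w - b * frechet_derivative p (at s) v"
proof -
  let ?F = "hamiltonian_field p" and ?p' = "\<lambda>x. frechet_derivative p (at x)"
  let ?F' = "\<lambda>x. frechet_derivative ?F (at x)"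
  have p': "(p has_derivative ?p' x) (at x)" for x
    using smooth_on_has_derivative[OF assms] by simp
  have linp': "linear (?p' x)" for x
    using p' by (rule has_derivative_linear)
  obtain \<epsilon> Y where \<epsilon>: "\<epsilon> > 0"
    and smooth: "\<And>\<tau>. smooth_on ({-\<epsilon><..<\<epsilon>} \<times> ball z \<epsilon>) (Y \<tau>)"
    and Y0: "\<And>t s. (t, s) \<in> {-\<epsilon><..<\<epsilon>} \<times> ball z \<epsilon> \<Longrightarrow> Y 0 (t, s) = s"
    and Y': "\<And>t s \<tau>. (t, s) \<in> {-\<epsilon><..<\<epsilon>} \<times> ball z \<epsilon> \<Longrightarrow> \<tau> \<in> {0..1} \<Longrightarrow>
       ((\<lambda>\<tau>. Y \<tau> (t, s)) has_vector_derivative t *\<^sub>R ?F (Y \<tau> (t, s))) (at \<tau> within {0..1})"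
    and W': "\<And>t s a v \<tau>. (t, s) \<in> {-\<epsilon><..<\<epsilon>} \<times> ball z \<epsilon> \<Longrightarrow> \<tau> \<in> {0..1} \<Longrightarrow>
       ((\<lambda>\<tau>. frechet_derivative (Y \<tau>) (at (t, s)) (a, v)) has_vector_derivative
         a *\<^sub>R ?F (Y \<tau> (t, s)) + t *\<^sub>R ?F' (Y \<tau> (t, s))
           (frechet_derivative (Y \<tau>) (at (t, s)) (a, v))) (at \<tau> within {0..1})"
    using local_flow[OF smooth_hamiltonian_field[OF assms], of z] by blast
  define T where "T = {-\<epsilon><..<\<epsilon>} \<times> ball z \<epsilon>"
  note facts = smooth[folded T_def] Y0[folded T_def] Y'[folded T_def] W'[folded T_def]
  have T: "open T" "(0, z) \<in> T"
    using \<epsilon> by (auto simp: T_def open_Times)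
  have energy: "p (Y \<tau> (t, s)) = p s" if ts: "(t, s) \<in> T" and "\<tau> \<in> {0..1}" for t s \<tau>
  proof -
    have "((\<lambda>\<tau>. p (Y \<tau> (t, s))) has_vector_derivative 0) (at \<tau> within {0..1})" if "\<tau> \<in> {0..1}" for \<tau>
    proof -
      have "?p' x (?F x) = 0" for x
        using sympl_flip[of "?F x" "?F x"] sympl_hamiltonian_field[OF assms, of x "?F x"] by simp
      then show ?thesis
        using has_derivative_compose[OF facts(3)[OF ts that, unfolded has_vector_derivative_def] p']
        by (simp add: has_vector_derivative_def linear_cmul[OF linp'])
    qed
    from zero_vector_derivative_01_eq[OF this that(2)] show ?thesis
      by (simp add: facts(2)[OF ts])
  qed
  have YD: "(Y \<tau> has_derivative frechet_derivative (Y \<tau>) (at x)) (at x)" if "x \<in> T" for x \<tau>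
    by (rule smooth_on_has_derivative[OF facts(1) that])
  have dp: "?p' (Y \<tau> (t, s)) (frechet_derivative (Y \<tau>) (at (t, s)) (a, v)) = ?p' s v"
    if ts: "(t, s) \<in> T" and "\<tau> \<in> {0..1}" for t s \<tau> a v
  proof -
    have "((\<lambda>x. p (Y \<tau> x)) has_derivative (\<lambda>x. ?p' (Y \<tau> (t, s)) (frechet_derivative (Y \<tau>) (at (t, s)) x))) (at (t, s))"
      by (rule has_derivative_compose[OF YD[OF ts] p'])
    then have "((\<lambda>x. p (snd x)) has_derivative (\<lambda>x. ?p' (Y \<tau> (t, s)) (frechet_derivative (Y \<tau>) (at (t, s)) x))) (at (t, s))"
      by (rule has_derivative_transform_within_open[OF _ T(1) ts]) (use energy that in auto)
    moreover have "((\<lambda>x. p (snd x)) has_derivative (\<lambda>x. ?p' s (snd x))) (at (t, s))"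
      by (rule has_derivative_compose[OF has_derivative_snd[OF has_derivative_ident], of p]) (simp add: p')
    ultimately show ?thesis
      using has_derivative_unique by (metis snd_conv)
  qed
  show thesis
  proof (rule that[OF T facts(1)[of 1]])
    show "p (Y 1 (t, s)) = p s" if "(t, s) \<in> T" for t s
      using energy[OF that] by simp
    show "Y 1 (0, z) = z"
      using zero_vector_derivative_01_eq[of "\<lambda>\<tau>. Y \<tau> (0, z)" 1] facts(2,3)[OF T(2)] by simp
    fix t s a v b w assume ts: "(t, s) \<in> T"
    define V where "V \<tau> = frechet_derivative (Y \<tau>) (at (t, s)) (a, v)" for \<tau>
    define W where "W \<tau> = frechet_derivative (Y \<tau>) (at (t, s)) (b, w)" for \<tau>
    define C where "C = a * ?p' s w - b * ?p' s v"
    have der: "((\<lambda>\<tau>. sympl (V \<tau>) (W \<tau>) - \<tau> * C) has_vector_derivative 0) (at \<tau> within {0..1})" if \<tau>: "\<tau> \<in> {0..1}" for \<tau>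
    proof -
      let ?x = "Y \<tau> (t, s)"
      have "((\<lambda>\<tau>. sympl (V \<tau>) (W \<tau>) - \<tau> * C) has_vector_derivative
          (sympl (V \<tau>) (b *\<^sub>R ?F ?x + t *\<^sub>R ?F' ?x (W \<tau>)) + sympl (a *\<^sub>R ?F ?x + t *\<^sub>R ?F' ?x (V \<tau>)) (W \<tau>)) - 1 * C) (at \<tau> within {0..1})"
        unfolding V_def W_def
        by (intro has_vector_derivative_diff sympl.has_vector_derivative facts(4)[OF ts \<tau>]
            has_vector_derivative_mult_left has_vector_derivative_id)
      also have "sympl (V \<tau>) (b *\<^sub>R ?F ?x + t *\<^sub>R ?F' ?x (W \<tau>)) = - sympl (b *\<^sub>R ?F ?x + t *\<^sub>R ?F' ?x (W \<tau>)) (V \<tau>)"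
        by (rule sympl_flip)
      also have "- sympl (b *\<^sub>R ?F ?x + t *\<^sub>R ?F' ?x (W \<tau>)) (V \<tau>) + sympl (a *\<^sub>R ?F ?x + t *\<^sub>R ?F' ?x (V \<tau>)) (W \<tau>) - 1 * C = 0"
        using dp[OF ts \<tau>, of a v] dp[OF ts \<tau>, of b w]
          mixed_derivatives_commute[OF smooth_onD[OF assms], of "V \<tau>" ?x "W \<tau>"]
        by (simp add: sympl.add_left sympl.scaleR_left sympl_hamiltonian_field[OF assms]
            sympl_derivative_hamiltonian_field[OF assms] C_def V_def[symmetric] W_def[symmetric])
      finally show ?thesis .
    qed
    have W0: "frechet_derivative (Y 0) (at (t, s)) x = snd x" for x
    proof -
      have "(Y 0 has_derivative snd) (at (t, s))"
        by (rule has_derivative_transform_within_open[OF has_derivative_snd[OF has_derivative_ident] T(1) ts])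
          (use facts(2) in auto)
      from frechet_derivative_at[OF this] show ?thesis by simp
    qed
    show "sympl (frechet_derivative (Y 1) (at (t, s)) (a, v)) (frechet_derivative (Y 1) (at (t, s)) (b, w))
       = sympl v w + a * ?p' s w - b * ?p' s v"
      using zero_vector_derivative_01_eq[OF der, of 1] by (simp add: V_def W_def W0 C_def)
  qed
qed

subsection \<open>Straightening\<close>

lemma sympl_shear:
  fixes u v :: "'n::finite phase_space"
  shows "sympl (u - coord_y i u *\<^sub>R e_y i + \<alpha> *\<^sub>R e_x i) (v - coord_y i v *\<^sub>R e_y i + \<beta> *\<^sub>R e_x i)
       = sympl u v + coord_y i u * coord_x i v - coord_y i v * coord_x i u"
  by (simp add: sympl_def e_x_def e_y_def coord_x_def coord_y_def inner_diff_left inner_diff_right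
      inner_add_left inner_add_right inner_axis inner_axis' axis_eq_axis algebra_simps)

theorem theorem1:
  fixes p :: "'n::{finite,linorder} phase_space \<Rightarrow> real"
    and W :: "'n phase_space set"
    and z :: "'n phase_space"
  assumes "smooth_on UNIV p"
    and "open W"
    and "\<And>w. w \<in> W \<Longrightarrow> partial_x first_index p w > 0"
    and "z \<in> W"
  shows "\<exists>U f. open U \<and> source_point p z \<in> U \<and> symplectomorphism_on U f \<and>
           f (source_point p z) = z \<and>
           (\<forall>w\<in>U. (p \<circ> f) w = coord_x first_index w)"
proof -
  let ?i = "first_index :: 'n"
  let ?p' = "\<lambda>x. frechet_derivative p (at x)"
  let ?x = "coord_x ?i" and ?y = "coord_y ?i"
  let ?q = "source_point p z"
  note x = linear_add[OF bounded_linear.linear[OF bounded_linear_coord_x]]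
    linear_diff[OF bounded_linear.linear[OF bounded_linear_coord_x]]
    linear_cmul[OF bounded_linear.linear[OF bounded_linear_coord_x]]
  note y = linear_add[OF bounded_linear.linear[OF bounded_linear_coord_y]]
    linear_diff[OF bounded_linear.linear[OF bounded_linear_coord_y]]
    linear_cmul[OF bounded_linear.linear[OF bounded_linear_coord_y]]
  have basis [simp]: "?x (e_x ?i) = 1" "?x (e_y ?i) = 0" "?y (e_x ?i) = 0" "?y (e_y ?i) = 1"
    by (simp_all add: coord_x_def coord_y_def e_x_def e_y_def)
  have p': "(p has_derivative ?p' s) (at s)" for s
    using smooth_on_has_derivative[OF assms(1)] by simp
  have linp': "linear (?p' s)" for s
    using p' by (rule has_derivative_linear)
  have "((\<lambda>t. p (z + t *\<^sub>R e_x ?i)) has_real_derivative ?p' z (e_x ?i)) (at 0)"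
    using has_real_derivative_directional[of p "?p' z" z 0 "e_x ?i" 0] p' by simp
  then have pos: "?p' z (e_x ?i) > 0"
    using assms(3)[OF assms(4)] by (simp add: partial_x_def DERIV_imp_deriv)

  define \<Theta> where "\<Theta> s = s + (p s - ?x s) *\<^sub>R e_x ?i" for s
  have \<Theta>': "(\<Theta> has_derivative (\<lambda>v. v + (?p' s v - ?x v) *\<^sub>R e_x ?i)) (at s)" for s
    unfolding \<Theta>_def[abs_def]
    by (intro has_derivative_add has_derivative_ident has_derivative_scaleR_left has_derivative_diff p'
        bounded_linear_imp_has_derivative bounded_linear_coord_x)
  have "smooth_on UNIV \<Theta>"
    unfolding smooth_on_def \<Theta>_def
    by (intro allI Ck_on_add Ck_on_diff Ck_on_linear_compose[OF bounded_linear_scaleR_left] open_UNIV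
        Ck_on_linear bounded_linear_ident bounded_linear_coord_x smooth_onD assms(1))
  moreover have "v = 0" if "frechet_derivative \<Theta> (at z) v = 0" for v
  proof -
    have v: "v = (?x v - ?p' z v) *\<^sub>R e_x ?i"
      using that by (simp add: frechet_derivative_at[OF \<Theta>', symmetric] eq_neg_iff_add_eq_0[symmetric]
          scaleR_minus_left[symmetric] del: scaleR_minus_left)
    have "?p' z v = (?x v - ?p' z v) * ?p' z (e_x ?i)" "?x v = ?x v - ?p' z v"
      using arg_cong[OF v, of "?p' z"] arg_cong[OF v, of ?x] by (simp_all add: linear_cmul[OF linp'] x)
    then have "?x v - ?p' z v = 0"
      using pos by simp
    then show ?thesis using v by simp
  qed
  ultimately obtain U0 where U0: "z \<in> U0" "diffeomorphism_onto_image U0 \<Theta>"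
    using smooth_inverse_function[OF open_UNIV _ UNIV_I] by metis
  define V where "V = \<Theta> ` U0"
  define \<kappa> where "\<kappa> = the_inv_into U0 \<Theta>"
  have V: "open V" "smooth_on V \<kappa>" and inj: "inj_on \<Theta> U0"
    using U0(2) by (auto simp: diffeomorphism_onto_image_def V_def \<kappa>_def)
  have \<Theta>\<kappa>: "\<Theta> (\<kappa> w) = w" if "w \<in> V" for w
    using f_the_inv_into_f[OF inj] that by (simp add: V_def \<kappa>_def)
  have \<Theta>z: "\<Theta> z = ?q"
    by (simp add: \<Theta>_def source_point_def)
  have \<kappa>q: "\<kappa> ?q = z"
    using the_inv_into_f_f[OF inj U0(1)] by (simp add: \<kappa>_def \<Theta>z)

  define \<pi> where "\<pi> w = w + (?y z - ?y w) *\<^sub>R e_y ?i" for w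
  have \<pi>q: "\<pi> ?q = ?q"
    by (simp add: \<pi>_def source_point_def y)
  have smooth_y: "smooth_on UNIV (\<lambda>w. ?y z - ?y w)"
    unfolding smooth_on_def
    by (intro allI Ck_on_diff Ck_on_const Ck_on_linear bounded_linear_coord_y open_UNIV)
  have smooth_\<pi>: "smooth_on UNIV \<pi>"
    unfolding smooth_on_def \<pi>_def
    by (intro allI Ck_on_add Ck_on_linear_compose[OF bounded_linear_scaleR_left] open_UNIV
        Ck_on_linear bounded_linear_ident smooth_onD smooth_y)
  define S1 where "S1 = \<pi> -` V"
  have S1: "open S1"
    unfolding S1_def using V(1) Ck_on_continuous_on[OF smooth_onD[OF smooth_\<pi>]]
    by (intro open_vimage) auto
  define \<sigma> where "\<sigma> w = \<kappa> (\<pi> w)" for w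
  have smooth_\<sigma>: "smooth_on S1 \<sigma>"
    unfolding \<sigma>_def
    by (rule smooth_on_compose[OF S1 V(1) _ smooth_on_subset[OF smooth_\<pi>] V(2)]) (auto simp: S1_def)
  have \<sigma>': "(\<sigma> has_derivative frechet_derivative \<sigma> (at w)) (at w)" if "w \<in> S1" for w
    by (rule smooth_on_has_derivative[OF smooth_\<sigma> that])
  have \<Theta>\<sigma>: "\<Theta> (\<sigma> w) = \<pi> w" if "w \<in> S1" for w
    using \<Theta>\<kappa> that by (simp add: S1_def \<sigma>_def)
  have p\<sigma>: "p (\<sigma> w) = ?x w" if "w \<in> S1" for w
    using arg_cong[OF \<Theta>\<sigma>[OF that], of ?x] by (simp add: \<Theta>_def \<pi>_def x)
  have \<sigma>_eq: "\<sigma> w = w + (?y z - ?y w) *\<^sub>R e_y ?i + (?x (\<sigma> w) - ?x w) *\<^sub>R e_x ?i" if "w \<in> S1" for w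
    using \<Theta>\<sigma>[OF that] by (simp add: \<Theta>_def \<pi>_def p\<sigma>[OF that] algebra_simps)
  have dp\<sigma>: "?p' (\<sigma> w) (frechet_derivative \<sigma> (at w) u) = ?x u" if "w \<in> S1" for w u
  proof -
    have "(?x has_derivative (\<lambda>u. ?p' (\<sigma> w) (frechet_derivative \<sigma> (at w) u))) (at w)"
      by (rule has_derivative_transform_within_open[OF has_derivative_compose[OF \<sigma>'[OF that] p'] S1 that p\<sigma>])
    then show ?thesis
      using has_derivative_unique[OF _ bounded_linear_imp_has_derivative[OF bounded_linear_coord_x]] by metis
  qed
  have d\<sigma>: "\<exists>\<alpha>. frechet_derivative \<sigma> (at w) u = u - ?y u *\<^sub>R e_y ?i + \<alpha> *\<^sub>R e_x ?i" if "w \<in> S1" for w u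
  proof -
    let ?\<sigma>' = "frechet_derivative \<sigma> (at w)"
    have "((\<lambda>w. w + (?y z - ?y w) *\<^sub>R e_y ?i + (?x (\<sigma> w) - ?x w) *\<^sub>R e_x ?i) has_derivative
        (\<lambda>u. u + (0 - ?y u) *\<^sub>R e_y ?i + (?x (?\<sigma>' u) - ?x u) *\<^sub>R e_x ?i)) (at w)"
      by (intro has_derivative_add has_derivative_ident has_derivative_scaleR_left has_derivative_diff
          has_derivative_const bounded_linear_imp_has_derivative bounded_linear_coord_x bounded_linear_coord_y
          bounded_linear.has_derivative[OF bounded_linear_coord_x \<sigma>'[OF that]])
    then have "(\<sigma> has_derivative (\<lambda>u. u + (0 - ?y u) *\<^sub>R e_y ?i + (?x (?\<sigma>' u) - ?x u) *\<^sub>R e_x ?i)) (at w)"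
      by (rule has_derivative_transform_within_open[OF _ S1 that]) (rule \<sigma>_eq[symmetric])
    from fun_cong[OF has_derivative_unique[OF \<sigma>'[OF that] this], of u]
    show ?thesis by auto
  qed

  obtain T \<Psi> where T: "open T" "(0, z) \<in> T" and smooth_\<Psi>: "smooth_on T \<Psi>" and \<Psi>0: "\<Psi> (0, z) = z"
    and p\<Psi>: "\<And>t s. (t, s) \<in> T \<Longrightarrow> p (\<Psi> (t, s)) = p s"
    and d\<Psi>: "\<And>t s a v b w. (t, s) \<in> T \<Longrightarrow>
       sympl (frechet_derivative \<Psi> (at (t, s)) (a, v)) (frechet_derivative \<Psi> (at (t, s)) (b, w))
       = sympl v w + a * ?p' s w - b * ?p' s v"
    using hamiltonian_flow[OF assms(1), of z] by metis
  define g where "g w = (?y z - ?y w, \<sigma> w)" for w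
  define S where "S = S1 \<inter> g -` T"
  have smooth_g: "smooth_on S1 g"
    unfolding smooth_on_def g_def
    by (intro allI Ck_on_Pair S1 smooth_onD smooth_\<sigma> smooth_on_subset[OF smooth_y subset_UNIV])
  have S: "open S"
    unfolding S_def
    by (intro continuous_open_preimage Ck_on_continuous_on[OF smooth_onD[OF smooth_g, of 0]] S1 T)
  define f where "f w = \<Psi> (g w)" for w
  have smooth_f: "smooth_on S f"
    unfolding f_def
    by (rule smooth_on_compose[OF S T(1) _ smooth_on_subset[OF smooth_g] smooth_\<Psi>]) (auto simp: S_def)
  have q: "?q \<in> S" "g ?q = (0, z)"
  proof -
    have "?q \<in> V"
      using U0(1) by (simp add: V_def \<Theta>z[symmetric])
    then have "?q \<in> S1"
      by (simp add: S1_def \<pi>q)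
    moreover show "g ?q = (0, z)"
      by (simp add: g_def \<sigma>_def \<pi>q \<kappa>q) (simp add: source_point_def y)
    ultimately show "?q \<in> S"
      using T(2) by (simp add: S_def)
  qed
  have f': "frechet_derivative f (at w) u = frechet_derivative \<Psi> (at (g w)) (- ?y u, frechet_derivative \<sigma> (at w) u)"
    if "w \<in> S" for w u
  proof -
    have w: "w \<in> S1" "g w \<in> T" using that by (auto simp: S_def)
    have "(g has_derivative (\<lambda>u. (0 - ?y u, frechet_derivative \<sigma> (at w) u))) (at w)"
      unfolding g_def[abs_def]
      by (intro has_derivative_Pair has_derivative_diff has_derivative_const bounded_linear_imp_has_derivative
          bounded_linear_coord_y \<sigma>' w)
    from fun_cong[OF frechet_derivative_at[OF has_derivative_compose[OF this smooth_on_has_derivative[OF smooth_\<Psi> w(2)]]], of u]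
    show ?thesis by (simp add: f_def[abs_def])
  qed
  have symplectic: "sympl (frechet_derivative f (at w) u) (frechet_derivative f (at w) v) = sympl u v"
    if "w \<in> S" for w u v
  proof -
    have w: "w \<in> S1" "(?y z - ?y w, \<sigma> w) \<in> T" using that by (auto simp: S_def g_def)
    obtain \<alpha> \<beta> where
      "frechet_derivative \<sigma> (at w) u = u - ?y u *\<^sub>R e_y ?i + \<alpha> *\<^sub>R e_x ?i"
      "frechet_derivative \<sigma> (at w) v = v - ?y v *\<^sub>R e_y ?i + \<beta> *\<^sub>R e_x ?i"
      using d\<sigma>[OF w(1)] by metis
    then have "sympl (frechet_derivative \<sigma> (at w) u) (frechet_derivative \<sigma> (at w) v)
        = sympl u v + ?y u * ?x v - ?y v * ?x u"
      by (simp only: sympl_shear)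
    then show ?thesis
      unfolding f'[OF that] g_def d\<Psi>[OF w(2)] dp\<sigma>[OF w(1)] by simp
  qed
  have "v = 0" if "frechet_derivative f (at ?q) v = 0" for v
    by (rule sympl_nondegenerate) (use symplectic[OF q(1), of v] that in \<open>simp add: sympl.zero_left\<close>)
  then obtain U where U: "U \<subseteq> S" "?q \<in> U" "diffeomorphism_onto_image U f"
    using smooth_inverse_function[OF S smooth_f q(1)] by metis
  have "symplectomorphism_on U f"
    using U(1,3) symplectic
    by (auto simp: symplectomorphism_on_def pullback2_def fun_eq_iff omega0_eq_sympl)
  moreover have "(p \<circ> f) w = ?x w" if "w \<in> U" for w
  proof -
    have "w \<in> S1" "(?y z - ?y w, \<sigma> w) \<in> T" using that U(1) by (auto simp: S_def g_def)
    then show ?thesis by (simp add: f_def g_def p\<Psi> p\<sigma>)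
  qed
  moreover have "f ?q = z"
    by (simp add: f_def q(2) \<Psi>0)
  moreover have "open U"
    using U(3) by (simp add: diffeomorphism_onto_image_def)
  ultimately show ?thesis
    using U(2) by blast
qed

end
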